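(* For (non-metric) facility location, set cover, and vertex cover, each formulated as a monotone covering instance as in the context, the greedy algorithm has a linear-time implementation (for facility location, time $O(\sum_i|N(i)|)$) that returns a $\Delta$-approximate solution. For facility location, $\Delta=\max_i|N(i)|$ is the maximum number of facilities that might serve any given customer.
   Context: Monotone covering: given a collection $\mathcal C$ of monotone (closed upwards under the componentwise order) subsets of $\mathbb R_+^n$ and a non-decreasing submodular cost $c:\mathbb R_+^n\to\mathbb R_+$ (i.e. $c(x)+c(y)\ge c(x\wedge y)+c(x\vee y)$, componentwise min/max), minimize $c(x)$ over $x$ with $x\in S$ for all $S\in\mathcal C$. $\mathrm{vars}(S)$ is the set of coordinates on which membership in $S$ depends and $\Delta=\max_S|\mathrm{vars}(S)|$; a solution is $\Delta$-approximate if it is feasible and has cost at most $\Delta$ times the optimum. The greedy algorithm: start with $x=\mathbf 0$; while some constraint $S$ is violated, pick one and perform a step: choose $\beta$ with $0\le\beta\le\inf\{c(\hat x)-c(x):\hat x\in S,\hat x\ge x\}$, and for every $j\in\mathrm{vars}(S)$ simultaneously raise $x_j$ to the largest value such that raising $x_j$ alone would increase $c(x)$ by at most $\beta$; finally round each variable down to its floor. Facility location: facilities $j$ with opening costs $f_j\ge0$, customers $i$, for each customer $i$ a set $N(i)$ of facilities that can serve it, and service costs $d_{ij}\ge0$; formulated as minimizing $\sum_j f_j\max_i x_{ij}+\sum_{i,j}d_{ij}x_{ij}$ over $x_{ij}\ge0$ ($j\in N(i)$) subject to, for each customer $i$, $\sum_{j\in N(i)}\lfloor x_{ij}\rfloor\ge1$.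 Set cover and vertex cover are the special cases with all $d_{ij}=0$ (for vertex cover: minimize $\sum_v c_vx_v$ subject to $\lfloor x_u\rfloor+\lfloor x_w\rfloor\ge1$ for each edge $(u,w)$, so $\Delta=2$; for set cover: minimize $\sum_s c_sx_s$ subject to $\sum_{s\ni e}\lfloor x_s\rfloor\ge1$ for each element $e$, so $\Delta$ is the maximum number of sets containing an element). *)

theory Defs
  imports "HOL-Library.Extended_Real"
begin

section \<open>Monotone covering\<close>

text \<open>
  Points of the orthant over a finite index set \<open>V\<close> are functions that vanish outside \<open>V\<close>,
  so that \<open>\<le>\<close>, \<open>inf\<close> and \<open>sup\<close> on functions are the componentwise operations.
\<close>

definition orthant :: "'v set \<Rightarrow> ('v \<Rightarrow> real) set" where
  "orthant V = {x. (\<forall>j\<in>V. 0 \<le> x j) \<and> (\<forall>j. j \<notin> V \<longrightarrow> x j = 0)}"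

record 'v covering =
  coords :: "'v set"
  cost :: "('v \<Rightarrow> real) \<Rightarrow> real"
  constraints :: "('v \<Rightarrow> real) set set"

definition monotone_in :: "'v set \<Rightarrow> ('v \<Rightarrow> real) set \<Rightarrow> bool" where
  "monotone_in V S \<longleftrightarrow> S \<subseteq> orthant V \<and> (\<forall>x\<in>S. \<forall>y\<in>orthant V. x \<le> y \<longrightarrow> y \<in> S)"

definition monotone_covering :: "'v covering \<Rightarrow> bool" where
  "monotone_covering M \<longleftrightarrow>
     finite (coords M) \<and>
     (\<forall>S\<in>constraints M. monotone_in (coords M) S) \<and>
     (\<forall>x\<in>orthant (coords M). 0 \<le> cost M x) \<and>
     (\<forall>x\<in>orthant (coords M). \<forall>y\<in>orthant (coords M). x \<le> y \<longrightarrow> cost M x \<le> cost M y) \<and>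
     (\<forall>x\<in>orthant (coords M). \<forall>y\<in>orthant (coords M).
        cost M (inf x y) + cost M (sup x y) \<le> cost M x + cost M y)"

definition vars :: "'v covering \<Rightarrow> ('v \<Rightarrow> real) set \<Rightarrow> 'v set" where
  "vars M S = {j \<in> coords M. \<exists>x\<in>orthant (coords M). \<exists>t\<ge>0. (x \<in> S) \<noteq> (x(j := t) \<in> S)}"

text \<open>On \<open>nat\<close>, \<open>Sup\<close> is the maximum of a finite set, and \<open>0\<close> if there are no constraints.\<close>

definition Delta :: "'v covering \<Rightarrow> nat" where
  "Delta M = (SUP S\<in>constraints M. card (vars M S))"

definition feasible :: "'v covering \<Rightarrow> ('v \<Rightarrow> real) set" where
  "feasible M = {x \<in> orthant (coords M). \<forall>S\<in>constraints M. x \<in> S}"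

definition opt :: "'v covering \<Rightarrow> real" where
  "opt M = (INF x\<in>feasible M. cost M x)"

definition Delta_approximate :: "'v covering \<Rightarrow> ('v \<Rightarrow> real) \<Rightarrow> bool" where
  "Delta_approximate M x \<longleftrightarrow> x \<in> feasible M \<and> cost M x \<le> real (Delta M) * opt M"


section \<open>The greedy algorithm\<close>

text \<open>
  \<open>raised M \<beta> x j t\<close>: the value \<open>t\<close> is what coordinate \<open>j\<close> is raised to. Normally \<open>t\<close> is the
  largest value such that raising coordinate \<open>j\<close> alone to it increases the cost by at most \<open>\<beta>\<close>.
  If arbitrarily large values have this property (for instance if the coordinate has cost zero)
  then the largest value is infinity; it is represented by a finite \<open>t\<close> that is as good as
  infinity, in that setting coordinate \<open>j\<close> to \<open>t\<close> never leads out of a constraint set.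
\<close>

definition admissible :: "'v covering \<Rightarrow> real \<Rightarrow> ('v \<Rightarrow> real) \<Rightarrow> 'v \<Rightarrow> real set" where
  "admissible M \<beta> x j = {t. x j \<le> t \<and> cost M (x(j := t)) - cost M x \<le> \<beta>}"

definition raised :: "'v covering \<Rightarrow> real \<Rightarrow> ('v \<Rightarrow> real) \<Rightarrow> 'v \<Rightarrow> real \<Rightarrow> bool" where
  "raised M \<beta> x j t \<longleftrightarrow> t \<in> admissible M \<beta> x j \<and>
     (if bdd_above (admissible M \<beta> x j)
      then \<forall>t'\<in>admissible M \<beta> x j. t' \<le> t
      else \<forall>S\<in>constraints M. \<forall>y\<in>S. y(j := t) \<in> S)"

text \<open>The infimum is taken in the extended reals, where that of the empty set is infinity.\<close>

definition greedy_step :: "'v covering \<Rightarrow> ('v \<Rightarrow> real) \<Rightarrow> ('v \<Rightarrow> real) \<Rightarrow> bool" where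
  "greedy_step M x x' \<longleftrightarrow>
     (\<exists>S\<in>constraints M. \<exists>\<beta>\<ge>0. x \<notin> S \<and>
        ereal \<beta> \<le> (INF y\<in>{y\<in>S. x \<le> y}. ereal (cost M y - cost M x)) \<and>
        (\<forall>j\<in>vars M S. raised M \<beta> x j (x' j)) \<and>
        (\<forall>j. j \<notin> vars M S \<longrightarrow> x' j = x j))"

text \<open>The choices of \<open>S\<close> and \<open>\<beta>\<close> are free, so several results are possible.\<close>

definition greedy_result :: "'v covering \<Rightarrow> ('v \<Rightarrow> real) \<Rightarrow> bool" where
  "greedy_result M z \<longleftrightarrow>
     (\<exists>x. (greedy_step M)\<^sup>*\<^sup>* (\<lambda>_. 0) x \<and> (\<forall>S\<in>constraints M. x \<in> S) \<and>
          z = (\<lambda>j. real_of_int \<lfloor>x j\<rfloor>))"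


section \<open>The machine model\<close>

text \<open>
  A real random access machine, programmed in a while language. The memory consists of named
  arrays of natural numbers, which alone can serve as addresses, and named arrays of reals.
  There is no conversion between the two sorts and no rounding of reals. Every constant, memory
  access, arithmetic operation, comparison and connective takes one unit of time.
\<close>

type_synonym name = string

record memory =
  nmem :: "name \<Rightarrow> nat \<Rightarrow> nat"
  rmem :: "name \<Rightarrow> nat \<Rightarrow> real"

datatype nexp = NConst nat | NLoad name nexp | NAdd nexp nexp | NSub nexp nexp

datatype rexp = RConst int | RLoad name nexp
  | RAdd rexp rexp | RSub rexp rexp | RMul rexp rexp | RDiv rexp rexp

datatype bexp = NLess nexp nexp | RLess rexp rexp | BNot bexp | BAnd bexp bexp

datatype com = Skip
  | NStore name nexp nexp
  | RStore name nexp rexp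
  | Seq com com
  | Cond bexp com com
  | While bexp com

primrec nval :: "nexp \<Rightarrow> memory \<Rightarrow> nat" where
  "nval (NConst k) s = k"
| "nval (NLoad a e) s = nmem s a (nval e s)"
| "nval (NAdd e e') s = nval e s + nval e' s"
| "nval (NSub e e') s = nval e s - nval e' s"

primrec rval :: "rexp \<Rightarrow> memory \<Rightarrow> real" where
  "rval (RConst k) s = of_int k"
| "rval (RLoad a e) s = rmem s a (nval e s)"
| "rval (RAdd e e') s = rval e s + rval e' s"
| "rval (RSub e e') s = rval e s - rval e' s"
| "rval (RMul e e') s = rval e s * rval e' s"
| "rval (RDiv e e') s = rval e s / rval e' s"

primrec bval :: "bexp \<Rightarrow> memory \<Rightarrow> bool" where
  "bval (NLess e e') s \<longleftrightarrow> nval e s < nval e' s"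
| "bval (RLess e e') s \<longleftrightarrow> rval e s < rval e' s"
| "bval (BNot b) s \<longleftrightarrow> \<not> bval b s"
| "bval (BAnd b b') s \<longleftrightarrow> bval b s \<and> bval b' s"

primrec ntime :: "nexp \<Rightarrow> nat" where
  "ntime (NConst k) = 1"
| "ntime (NLoad a e) = 1 + ntime e"
| "ntime (NAdd e e') = 1 + ntime e + ntime e'"
| "ntime (NSub e e') = 1 + ntime e + ntime e'"

primrec rtime :: "rexp \<Rightarrow> nat" where
  "rtime (RConst k) = 1"
| "rtime (RLoad a e) = 1 + ntime e"
| "rtime (RAdd e e') = 1 + rtime e + rtime e'"
| "rtime (RSub e e') = 1 + rtime e + rtime e'"
| "rtime (RMul e e') = 1 + rtime e + rtime e'"
| "rtime (RDiv e e') = 1 + rtime e + rtime e'"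

primrec btime :: "bexp \<Rightarrow> nat" where
  "btime (NLess e e') = 1 + ntime e + ntime e'"
| "btime (RLess e e') = 1 + rtime e + rtime e'"
| "btime (BNot b) = 1 + btime b"
| "btime (BAnd b b') = 1 + btime b + btime b'"

text \<open>\<open>exec p s t s'\<close>: started in \<open>s\<close>, the program \<open>p\<close> halts in \<open>s'\<close> after time \<open>t\<close>.\<close>

inductive exec :: "com \<Rightarrow> memory \<Rightarrow> nat \<Rightarrow> memory \<Rightarrow> bool" where
  Skip: "exec Skip s 1 s"
| NStore: "exec (NStore a i e) s (1 + ntime i + ntime e)
     (s\<lparr>nmem := (nmem s)(a := (nmem s a)(nval i s := nval e s))\<rparr>)"
| RStore: "exec (RStore a i e) s (1 + ntime i + rtime e)
     (s\<lparr>rmem := (rmem s)(a := (rmem s a)(nval i s := rval e s))\<rparr>)"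
| Seq: "exec p s t s' \<Longrightarrow> exec q s' t' s'' \<Longrightarrow> exec (Seq p q) s (t + t') s''"
| CondTrue: "bval b s \<Longrightarrow> exec p s t s' \<Longrightarrow> exec (Cond b p q) s (1 + btime b + t) s'"
| CondFalse: "\<not> bval b s \<Longrightarrow> exec q s t s' \<Longrightarrow> exec (Cond b p q) s (1 + btime b + t) s'"
| WhileFalse: "\<not> bval b s \<Longrightarrow> exec (While b p) s (1 + btime b) s"
| WhileTrue: "bval b s \<Longrightarrow> exec p s t s' \<Longrightarrow> exec (While b p) s' t' s'' \<Longrightarrow>
     exec (While b p) s (1 + btime b + t + t') s''"

text \<open>
  A single program handles all instances \<open>I\<close> satisfying \<open>valid\<close>: started in any memory that holds
  \<open>I\<close> (according to \<open>inp\<close>; all other cells are arbitrary), it halts within time linear in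
  \<open>sz I\<close>, and the solution \<open>z\<close> it leaves in memory (according to \<open>outp\<close>, which also refers to
  the initial memory) is a possible result of the greedy algorithm and is approximate.
\<close>

definition linear_time_greedy ::
  "('i \<Rightarrow> bool) \<Rightarrow> ('i \<Rightarrow> 'v covering) \<Rightarrow> ('i \<Rightarrow> nat) \<Rightarrow> ('i \<Rightarrow> memory \<Rightarrow> bool) \<Rightarrow>
   ('i \<Rightarrow> memory \<Rightarrow> memory \<Rightarrow> ('v \<Rightarrow> real) \<Rightarrow> bool) \<Rightarrow> bool" where
  "linear_time_greedy valid M sz inp outp \<longleftrightarrow>
     (\<exists>p K. \<forall>I s. valid I \<longrightarrow> inp I s \<longrightarrow>
        (\<exists>t s' z. exec p s t s' \<and> t \<le> K * (sz I + 1) \<and> outp I s s' z \<and>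
           greedy_result (M I) z \<and> Delta_approximate (M I) z))"


section \<open>Facility location\<close>

record facility_instance =
  customers :: nat
  facilities :: nat
  serving :: "nat \<Rightarrow> nat set"
  opening_cost :: "nat \<Rightarrow> real"
  service_cost :: "nat \<Rightarrow> nat \<Rightarrow> real"

text \<open>Every customer can be served, as otherwise there is no feasible solution.\<close>

definition facility_location :: "facility_instance \<Rightarrow> bool" where
  "facility_location I \<longleftrightarrow>
     (\<forall>i<customers I. serving I i \<noteq> {} \<and> serving I i \<subseteq> {..<facilities I}) \<and>
     (\<forall>j<facilities I. 0 \<le> opening_cost I j) \<and>
     (\<forall>i<customers I. \<forall>j\<in>serving I i. 0 \<le> service_cost I i j)"

text \<open>The additional \<open>0\<close> in the maximum only matters for facilities that serve no customer.\<close>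

definition fl_covering :: "facility_instance \<Rightarrow> (nat \<times> nat) covering" where
  "fl_covering I = \<lparr>
     coords = Sigma {..<customers I} (serving I),
     cost = (\<lambda>x.
       (\<Sum>j<facilities I. opening_cost I j *
          Max (insert 0 ((\<lambda>i. x (i, j)) ` {i. i < customers I \<and> j \<in> serving I i}))) +
       (\<Sum>i<customers I. \<Sum>j\<in>serving I i. service_cost I i j * x (i, j))),
     constraints = (\<lambda>i. {x \<in> orthant (Sigma {..<customers I} (serving I)).
       (\<Sum>j\<in>serving I i. \<lfloor>x (i, j)\<rfloor>) \<ge> 1}) ` {..<customers I}\<rparr>"

definition fl_size :: "facility_instance \<Rightarrow> nat" where
  "fl_size I = (\<Sum>i<customers I. card (serving I i))"

text \<open>
  Adjacency lists: the facilities that can serve customer \<open>i\<close>, without repetitions, are the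
  entries of \<open>adj\<close> at positions \<open>off i, \<dots>, off (i + 1) - 1\<close>, with the service costs at the same
  positions of \<open>dist\<close>. The solution is stored at the same positions of \<open>x\<close>.
\<close>

definition fl_input :: "facility_instance \<Rightarrow> memory \<Rightarrow> bool" where
  "fl_input I s \<longleftrightarrow>
     nmem s ''m'' 0 = customers I \<and> nmem s ''n'' 0 = facilities I \<and>
     (\<forall>j<facilities I. rmem s ''open'' j = opening_cost I j) \<and>
     nmem s ''off'' 0 = 0 \<and>
     (\<forall>i<customers I.
        nmem s ''off'' (i + 1) = nmem s ''off'' i + card (serving I i) \<and>
        bij_betw (nmem s ''adj'') {nmem s ''off'' i..<nmem s ''off'' (i + 1)} (serving I i) \<and>
        (\<forall>k\<in>{nmem s ''off'' i..<nmem s ''off'' (i + 1)}.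
           rmem s ''dist'' k = service_cost I i (nmem s ''adj'' k)))"

definition fl_output ::
  "facility_instance \<Rightarrow> memory \<Rightarrow> memory \<Rightarrow> (nat \<times> nat \<Rightarrow> real) \<Rightarrow> bool" where
  "fl_output I s s' z \<longleftrightarrow>
     (\<forall>i<customers I. \<forall>k\<in>{nmem s ''off'' i..<nmem s ''off'' (i + 1)}.
        rmem s' ''x'' k = z (i, nmem s ''adj'' k))"


section \<open>Set cover\<close>

record set_cover_instance =
  elements :: nat
  num_sets :: nat
  members :: "nat \<Rightarrow> nat set"
  set_cost :: "nat \<Rightarrow> real"

definition set_cover :: "set_cover_instance \<Rightarrow> bool" where
  "set_cover I \<longleftrightarrow>
     (\<forall>j<num_sets I. members I j \<subseteq> {..<elements I} \<and> 0 \<le> set_cost I j) \<and>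
     (\<forall>e<elements I. \<exists>j<num_sets I. e \<in> members I j)"

definition containing :: "set_cover_instance \<Rightarrow> nat \<Rightarrow> nat set" where
  "containing I e = {j. j < num_sets I \<and> e \<in> members I j}"

definition sc_covering :: "set_cover_instance \<Rightarrow> nat covering" where
  "sc_covering I = \<lparr>
     coords = {..<num_sets I},
     cost = (\<lambda>x. \<Sum>j<num_sets I. set_cost I j * x j),
     constraints = (\<lambda>e. {x \<in> orthant {..<num_sets I}.
       (\<Sum>j\<in>containing I e. \<lfloor>x j\<rfloor>) \<ge> 1}) ` {..<elements I}\<rparr>"

definition sc_size :: "set_cover_instance \<Rightarrow> nat" where
  "sc_size I = num_sets I + elements I + (\<Sum>j<num_sets I. card (members I j))"

text \<open>The sets containing the element \<open>e\<close> are at positions \<open>off e, \<dots>, off (e + 1) - 1\<close> of \<open>adj\<close>.\<close>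

definition sc_input :: "set_cover_instance \<Rightarrow> memory \<Rightarrow> bool" where
  "sc_input I s \<longleftrightarrow>
     nmem s ''m'' 0 = elements I \<and> nmem s ''n'' 0 = num_sets I \<and>
     (\<forall>j<num_sets I. rmem s ''cost'' j = set_cost I j) \<and>
     nmem s ''off'' 0 = 0 \<and>
     (\<forall>e<elements I.
        nmem s ''off'' (e + 1) = nmem s ''off'' e + card (containing I e) \<and>
        bij_betw (nmem s ''adj'') {nmem s ''off'' e..<nmem s ''off'' (e + 1)} (containing I e))"

definition sc_output ::
  "set_cover_instance \<Rightarrow> memory \<Rightarrow> memory \<Rightarrow> (nat \<Rightarrow> real) \<Rightarrow> bool" where
  "sc_output I s s' z \<longleftrightarrow> (\<forall>j<num_sets I. rmem s' ''x'' j = z j)"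


section \<open>Vertex cover\<close>

record vertex_cover_instance =
  vertices :: nat
  edges :: "nat set set"
  vertex_cost :: "nat \<Rightarrow> real"

definition vertex_cover :: "vertex_cover_instance \<Rightarrow> bool" where
  "vertex_cover I \<longleftrightarrow>
     (\<forall>e\<in>edges I. e \<subseteq> {..<vertices I} \<and> card e = 2) \<and>
     (\<forall>v<vertices I. 0 \<le> vertex_cost I v)"

definition vc_covering :: "vertex_cover_instance \<Rightarrow> nat covering" where
  "vc_covering I = \<lparr>
     coords = {..<vertices I},
     cost = (\<lambda>x. \<Sum>v<vertices I. vertex_cost I v * x v),
     constraints = {{x \<in> orthant {..<vertices I}. \<lfloor>x u\<rfloor> + \<lfloor>x w\<rfloor> \<ge> 1} | u w. {u, w} \<in> edges I}\<rparr>"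

definition vc_size :: "vertex_cover_instance \<Rightarrow> nat" where
  "vc_size I = vertices I + card (edges I)"

text \<open>An edge list without repetitions.\<close>

definition vc_input :: "vertex_cover_instance \<Rightarrow> memory \<Rightarrow> bool" where
  "vc_input I s \<longleftrightarrow>
     nmem s ''m'' 0 = card (edges I) \<and> nmem s ''n'' 0 = vertices I \<and>
     (\<forall>v<vertices I. rmem s ''cost'' v = vertex_cost I v) \<and>
     bij_betw (\<lambda>k. {nmem s ''tail'' k, nmem s ''head'' k}) {..<card (edges I)} (edges I)"

definition vc_output ::
  "vertex_cover_instance \<Rightarrow> memory \<Rightarrow> memory \<Rightarrow> (nat \<Rightarrow> real) \<Rightarrow> bool" where
  "vc_output I s s' z \<longleftrightarrow> (\<forall>v<vertices I. rmem s' ''x'' v = z v)"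

end

theory Submission
  imports Defs
begin

text \<open>
  A greedy step with increment \<open>\<beta>\<close> raises the cost by at most \<open>\<Delta> \<beta>\<close>, by submodularity. If every
  coordinate of the constraint uses up exactly \<open>\<beta>\<close>, the residual cost \<open>c (x \<squnion> z) - c x\<close> of any
  feasible \<open>z\<close> drops by at least \<open>\<beta>\<close>. Summing up bounds the final cost by \<open>\<Delta> c z\<close>.

  For facility location, customer \<open>i\<close> is treated once, with the maximal increment
  \<open>\<beta> = min\<^sub>j (d\<^sub>i\<^sub>j + f\<^sub>j (1 - y\<^sub>j))\<close>, where \<open>y\<^sub>j\<close> is the current value of \<open>max\<^sub>i x\<^sub>i\<^sub>j\<close>. Then
  \<open>x\<^sub>i\<^sub>j\<close> solves \<open>d\<^sub>i\<^sub>j t + f\<^sub>j max 0 (t - y\<^sub>j) = \<beta>\<close> and stays in the unit interval, so only the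
  levels \<open>y\<^sub>j\<close> have to be maintained, and rounding down is a comparison with \<open>1\<close>. With \<open>d = 0\<close> the
  levels themselves form a greedy run for set cover; vertex cover is set cover whose elements are
  the edges.
\<close>

section \<open>Greedy runs that use up the whole increment\<close>

text \<open>The greedy rule only bounds each raise by \<open>\<beta>\<close>, whereas the drop of
  the residual cost needs equality; this is what \<open>tight_step\<close> adds. Equality is
  available because the cost is continuous in each coordinate, and a coordinate that costs nothing
  has price \<open>0\<close>, which forces \<open>\<beta> = 0\<close>. Such a free coordinate has no
  largest value; it is put to \<open>1\<close>, which is as good as infinity when constraints only
  ask for some coordinate to be at least \<open>1\<close>.

  Taking the smallest price as increment makes the coordinate that attains it reach exactly
  \<open>1\<close>. So each constraint is settled when it is first met, and a single scan over the
  constraints suffices.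

  Sharing one program has one delicate point. In set cover the variables belong to several
  constraints, so a constraint may already hold when its turn comes, and then no step is allowed.
  The increment is \<open>0\<close> in that case, so only free coordinates could move; a flag keeps
  them in place.\<close>

definition tight_step :: "'v covering \<Rightarrow> ('v \<Rightarrow> real) \<Rightarrow> ('v \<Rightarrow> real) \<Rightarrow> bool" where
  "tight_step M x x' \<longleftrightarrow>
     (\<exists>S\<in>constraints M. \<exists>\<beta>\<ge>0. x \<notin> S \<and> (\<forall>y\<in>S. x \<le> y \<longrightarrow> cost M x + \<beta> \<le> cost M y) \<and>
        (\<forall>j\<in>vars M S. raised M \<beta> x j (x' j) \<and> cost M (x(j := x' j)) = cost M x + \<beta>) \<and>
        (\<forall>j. j \<notin> vars M S \<longrightarrow> x' j = x j))"

lemma tight_step_imp_greedy_step: "tight_step M x x' \<Longrightarrow> greedy_step M x x'"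
  unfolding tight_step_def greedy_step_def
  by (elim bexE exE conjE, rule bexI, rule exI) (auto intro!: INF_greatest simp: algebra_simps)

lemma orthantI: "(\<And>j. j \<in> V \<Longrightarrow> 0 \<le> x j) \<Longrightarrow> (\<And>j. j \<notin> V \<Longrightarrow> x j = 0) \<Longrightarrow> x \<in> orthant V"
  by (simp add: orthant_def)

lemma orthant_nonneg: "x \<in> orthant V \<Longrightarrow> 0 \<le> x j"
  by (cases "j \<in> V") (auto simp: orthant_def)

lemma orthant_upd: "x \<in> orthant V \<Longrightarrow> j \<in> V \<Longrightarrow> 0 \<le> t \<Longrightarrow> x(j := t) \<in> orthant V"
  by (auto simp: orthant_def)

lemma orthant_sup: "x \<in> orthant V \<Longrightarrow> y \<in> orthant V \<Longrightarrow> sup x y \<in> orthant V"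
  by (auto simp: orthant_def sup_real_def)

lemma orthant_inf: "x \<in> orthant V \<Longrightarrow> y \<in> orthant V \<Longrightarrow> inf x y \<in> orthant V"
  by (auto simp: orthant_def inf_real_def)

text \<open>\<open>vars\<close> only speaks about changing one coordinate at a time. So
  \<open>x\<close> is turned into \<open>y\<close> coordinate by coordinate, and finiteness of
  \<open>coords M\<close> makes this end at \<open>y\<close>. All intermediate points lie in the
  orthant because \<open>x\<close> and \<open>y\<close> do.\<close>

lemma mem_cong_vars:
  assumes fin: "finite (coords M)" and x: "x \<in> orthant (coords M)" and y: "y \<in> orthant (coords M)"
    and eq: "\<And>j. j \<in> vars M S \<Longrightarrow> x j = y j" and mem: "x \<in> S"
  shows "y \<in> S"
proof -
  have "(\<lambda>j. if j \<in> F then y j else x j) \<in> S" if "finite F" "F \<subseteq> coords M" for F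
    using that
  proof (induction F rule: finite_induct)
    case empty
    then show ?case using mem by simp
  next
    case (insert j F)
    define w where "w = (\<lambda>i. if i \<in> F then y i else x i)"
    have w: "w \<in> orthant (coords M)" "w \<in> S"
      using x y insert by (auto simp: w_def orthant_def)
    have "w(j := y j) \<in> S"
    proof (cases "j \<in> vars M S")
      case True
      then have "w(j := y j) = w"
        using eq insert.hyps by (auto simp: w_def)
      then show ?thesis using w by simp
    next
      case False
      then show ?thesis
        using w insert.prems orthant_nonneg[OF y, of j] by (auto simp: vars_def)
    qed
    moreover have "w(j := y j) = (\<lambda>i. if i \<in> insert j F then y i else x i)"
      by (auto simp: w_def)
    ultimately show ?case by simp
  qed
  from this[OF fin subset_refl] have "(\<lambda>j. if j \<in> coords M then y j else x j) \<in> S" .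
  moreover have "(\<lambda>j. if j \<in> coords M then y j else x j) = y"
    using x y by (auto simp: orthant_def)
  ultimately show ?thesis by simp
qed

lemma monotone_coveringD:
  assumes "monotone_covering M"
  shows "finite (coords M)"
    and "S \<in> constraints M \<Longrightarrow> x \<in> S \<Longrightarrow> y \<in> orthant (coords M) \<Longrightarrow> x \<le> y \<Longrightarrow> y \<in> S"
    and "S \<in> constraints M \<Longrightarrow> x \<in> S \<Longrightarrow> x \<in> orthant (coords M)"
    and "x \<in> orthant (coords M) \<Longrightarrow> y \<in> orthant (coords M) \<Longrightarrow> x \<le> y \<Longrightarrow> cost M x \<le> cost M y"
    and "x \<in> orthant (coords M) \<Longrightarrow> y \<in> orthant (coords M) \<Longrightarrow>
           cost M (inf x y) + cost M (sup x y) \<le> cost M x + cost M y"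
  using assms unfolding monotone_covering_def monotone_in_def by blast+

text \<open>Submodularity makes marginal costs decrease: a point \<open>w\<close> with some
  coordinates already raised and the single raise \<open>x(j := x' j)\<close> meet in
  \<open>x\<close> and join in the next point. Hence raising \<open>j\<close> from \<open>w\<close>
  costs at most what it costs from \<open>x\<close>, which is at most
  \<open>\<beta>\<close>.\<close>

lemma cost_raise_le:
  assumes M: "monotone_covering M" and x: "x \<in> orthant (coords M)" and x': "x' \<in> orthant (coords M)"
    and le: "x \<le> x'" and fin: "finite U" and out: "\<And>j. j \<notin> U \<Longrightarrow> x' j = x j"
    and each: "\<And>j. j \<in> U \<Longrightarrow> cost M (x(j := x' j)) \<le> cost M x + \<beta>"
  shows "cost M x' \<le> cost M x + real (card U) * \<beta>"
proof -
  have "cost M (\<lambda>j. if j \<in> F then x' j else x j) \<le> cost M x + real (card F) * \<beta>"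
    if "finite F" "F \<subseteq> U" for F
    using that
  proof (induction F rule: finite_induct)
    case empty
    then show ?case by simp
  next
    case (insert j F)
    define w where "w = (\<lambda>i. if i \<in> F then x' i else x i)"
    have w: "w \<in> orthant (coords M)"
      using x x' by (auto simp: w_def orthant_def)
    have u: "x(j := x' j) \<in> orthant (coords M)"
      using x x' by (auto simp: orthant_def)
    have "inf w (x(j := x' j)) = x" "sup w (x(j := x' j)) = (\<lambda>i. if i \<in> insert j F then x' i else x i)"
      using le insert.hyps by (auto simp: w_def le_fun_def fun_eq_iff inf_real_def sup_real_def min_def max_def antisym)
    then have "cost M x + cost M (\<lambda>i. if i \<in> insert j F then x' i else x i)
        \<le> cost M w + cost M (x(j := x' j))"
      using monotone_coveringD(5)[OF M w u] by simp
    moreover have "cost M w \<le> cost M x + real (card F) * \<beta>"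
      using insert by (simp add: w_def)
    moreover have "cost M (x(j := x' j)) \<le> cost M x + \<beta>"
      using each insert.prems by blast
    ultimately show ?case
      using insert.hyps by (simp add: algebra_simps)
  qed
  from this[OF fin subset_refl] show ?thesis
    by (rule back_subst[where P = "\<lambda>y. cost M y \<le> _"]) (auto simp: out)
qed

text \<open>
  The residual cost \<open>cost M (sup x z) - cost M x\<close> of a feasible \<open>z\<close> pays for the increase: by
  submodularity it drops by at least the cost of raising \<open>x\<close> to \<open>inf x' (sup x z)\<close>. Either this
  point satisfies the constraint, or it dominates one of the single-coordinate raises.
\<close>

lemma tight_step_potential:
  assumes M: "monotone_covering M" and x: "x \<in> orthant (coords M)" and step: "tight_step M x x'"
    and z: "z \<in> feasible M" and D: "\<And>S. S \<in> constraints M \<Longrightarrow> card (vars M S) \<le> D"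
  shows "x' \<in> orthant (coords M)"
    and "cost M x' + real D * (cost M (sup x' z) - cost M x')
      \<le> cost M x + real D * (cost M (sup x z) - cost M x)"
proof -
  note [simp] = monotone_coveringD(1)[OF M]
  from step obtain S \<beta> where S: "S \<in> constraints M" and \<beta>: "0 \<le> \<beta>" "x \<notin> S"
    and low: "\<And>y. y \<in> S \<Longrightarrow> x \<le> y \<Longrightarrow> cost M x + \<beta> \<le> cost M y"
    and ra: "\<And>j. j \<in> vars M S \<Longrightarrow> raised M \<beta> x j (x' j)"
    and tight: "\<And>j. j \<in> vars M S \<Longrightarrow> cost M (x(j := x' j)) = cost M x + \<beta>"
    and out: "\<And>j. j \<notin> vars M S \<Longrightarrow> x' j = x j"
    unfolding tight_step_def by blast
  have vV: "vars M S \<subseteq> coords M" by (auto simp: vars_def)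
  then have finv: "finite (vars M S)" by (rule finite_subset) simp
  have le: "x \<le> x'"
  proof (rule le_funI)
    fix j show "x j \<le> x' j"
      using ra[of j] out[of j] by (cases "j \<in> vars M S") (auto simp: raised_def admissible_def)
  qed
  show x': "x' \<in> orthant (coords M)"
  proof (rule orthantI)
    fix j show "0 \<le> x' j"
      using orthant_nonneg[OF x, of j] le_funD[OF le, of j] by linarith
  next
    fix j assume "j \<notin> coords M"
    then show "x' j = 0" using out[of j] vV x by (auto simp: orthant_def)
  qed
  have zo: "z \<in> orthant (coords M)" and zS: "z \<in> S"
    using z S by (auto simp: feasible_def)
  define w where "w = inf x' (sup x z)"
  have w: "w \<in> orthant (coords M)"
    unfolding w_def by (intro orthant_inf orthant_sup x x' zo)
  have xw: "x \<le> w" using le by (simp add: w_def)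
  have drop: "cost M x + \<beta> \<le> cost M w"
  proof (cases "\<exists>k\<in>vars M S. x' k < z k")
    case True
    then obtain k where k: "k \<in> vars M S" "x' k < z k" by blast
    have "x(k := x' k) \<le> w"
      using xw k by (auto simp: le_fun_def w_def inf_real_def sup_real_def)
    moreover have "x(k := x' k) \<in> orthant (coords M)"
      using k vV orthant_nonneg[OF x', of k] by (intro orthant_upd x) auto
    ultimately have "cost M (x(k := x' k)) \<le> cost M w"
      using monotone_coveringD(4)[OF M] w by blast
    then show ?thesis using tight k by simp
  next
    case False
    \<comment> \<open>Outside \<open>vars M S\<close> the point \<open>w\<close> equals
      \<open>x\<close> and may lie below \<open>z\<close>, so monotonicity does not apply to
      \<open>w\<close> itself. The hybrid \<open>w'\<close> dominates \<open>z\<close> and agrees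
      with \<open>w\<close> on the coordinates that decide membership in \<open>S\<close>.\<close>
    define w' where "w' = (\<lambda>j. if j \<in> vars M S then w j else z j)"
    have w': "w' \<in> orthant (coords M)"
      using w zo by (auto simp: w'_def orthant_def)
    have "z \<le> w'"
      using False by (force simp: w'_def w_def le_fun_def inf_real_def sup_real_def not_less)
    then have "w' \<in> S"
      using monotone_coveringD(2)[OF M S zS w'] by blast
    then have "w \<in> S"
      by (rule mem_cong_vars[OF _ w' w, rotated -1]) (auto simp: w'_def)
    then show ?thesis using low xw by blast
  qed
  have "sup x' (sup x z) = sup x' z"
    using le by (metis sup.absorb1 sup.assoc)
  then have "cost M w + cost M (sup x' z) \<le> cost M x' + cost M (sup x z)"
    using monotone_coveringD(5)[OF M x' orthant_sup[OF x zo]] by (simp add: w_def)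
  then have "\<beta> \<le> (cost M (sup x z) - cost M x) - (cost M (sup x' z) - cost M x')"
    using drop by linarith
  then have "real D * \<beta> \<le> real D * ((cost M (sup x z) - cost M x) - (cost M (sup x' z) - cost M x'))"
    by (intro mult_left_mono) auto
  moreover have "cost M x' \<le> cost M x + real (card (vars M S)) * \<beta>"
    using out tight by (intro cost_raise_le[OF M x x' le finv]) auto
  moreover have "real (card (vars M S)) * \<beta> \<le> real D * \<beta>"
    using D[OF S] \<beta> by (intro mult_right_mono) auto
  ultimately show "cost M x' + real D * (cost M (sup x' z) - cost M x')
      \<le> cost M x + real D * (cost M (sup x z) - cost M x)"
    by (simp add: algebra_simps)
qed

lemma card_vars_le_Delta:
  assumes "finite (coords M)" and "S \<in> constraints M"
  shows "card (vars M S) \<le> Delta M"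
  unfolding Delta_def
proof (rule cSUP_upper[OF assms(2)])
  show "bdd_above ((\<lambda>S. card (vars M S)) ` constraints M)"
    using assms(1) by (auto intro!: bdd_aboveI[of _ "card (coords M)"] card_mono simp: vars_def)
qed

lemma tight_run_cost:
  assumes M: "monotone_covering M" and zero: "cost M (\<lambda>_. 0) = 0"
    and run: "(tight_step M)\<^sup>*\<^sup>* (\<lambda>_. 0) x" and z: "z \<in> feasible M"
  shows "cost M x \<le> real (Delta M) * cost M z"
proof -
  have zo: "z \<in> orthant (coords M)"
    using z by (simp add: feasible_def)
  have "x \<in> orthant (coords M) \<and>
      cost M x + real (Delta M) * (cost M (sup x z) - cost M x) \<le> real (Delta M) * cost M z"
    using run
  proof (induction rule: rtranclp_induct)
    case base
    have "sup (\<lambda>_. 0) z = z"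
      using orthant_nonneg[OF zo] by (auto simp: fun_eq_iff sup_real_def max_def intro: antisym)
    then show ?case by (simp add: zero orthant_def)
  next
    case (step x x')
    then have x: "x \<in> orthant (coords M)" by blast
    show ?case
      using tight_step_potential[OF M x step.hyps(2) z card_vars_le_Delta[OF monotone_coveringD(1)[OF M]]]
        step.IH by linarith
  qed
  moreover from this have "cost M x \<le> cost M (sup x z)"
    using zo by (intro monotone_coveringD(4)[OF M]) (auto intro: orthant_sup)
  then have "0 \<le> real (Delta M) * (cost M (sup x z) - cost M x)"
    by simp
  ultimately show ?thesis by linarith
qed

text \<open>Monotonicity transfers in both directions between \<open>x\<close> and its rounding
  \<open>z\<close>: feasibility goes up from \<open>z\<close> to \<open>x\<close>, which is the exit
  condition of the greedy loop, and the cost bound goes down from \<open>x\<close> to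
  \<open>z\<close>.\<close>

lemma Delta_approximate_tight_run:
  assumes M: "monotone_covering M" and zero: "cost M (\<lambda>_. 0) = 0"
    and run: "(tight_step M)\<^sup>*\<^sup>* (\<lambda>_. 0) x" and x: "x \<in> orthant (coords M)"
    and z: "z = (\<lambda>j. real_of_int \<lfloor>x j\<rfloor>)" and feas: "z \<in> feasible M"
  shows "greedy_result M z \<and> Delta_approximate M z"
proof
  have zo: "z \<in> orthant (coords M)" using feas by (simp add: feasible_def)
  have zx: "z \<le> x" by (auto simp: z le_fun_def)
  have "(greedy_step M)\<^sup>*\<^sup>* (\<lambda>_. 0) x"
    using run by (rule rtranclp_mono[THEN predicate2D, rotated]) (auto intro: tight_step_imp_greedy_step)
  moreover have "\<forall>S\<in>constraints M. x \<in> S"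
    using feas monotone_coveringD(2)[OF M _ _ x zx] by (auto simp: feasible_def)
  ultimately show "greedy_result M z"
    unfolding greedy_result_def using z by blast
  have "cost M z \<le> cost M x"
    by (rule monotone_coveringD(4)[OF M zo x zx])
  then have bound: "cost M z \<le> real (Delta M) * cost M y" if "y \<in> feasible M" for y
    using tight_run_cost[OF M zero run that] by linarith
  have "cost M z \<le> real (Delta M) * opt M"
  \<comment> \<open>\<open>opt M\<close> is an infimum that might not be attained, so the bound
    against every feasible point is divided by \<open>Delta M\<close> before the infimum is taken.
    For \<open>Delta M = 0\<close> the bound, applied to \<open>z\<close> itself, already says that
    the cost is at most \<open>0\<close>.\<close>
  proof (cases "Delta M = 0")
    case True
    then show ?thesis using bound[OF feas] by simp
  next
    case False
    then have "cost M z / real (Delta M) \<le> opt M"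
      unfolding opt_def using bound feas by (intro cINF_greatest) (auto simp: field_simps)
    then show ?thesis using False by (simp add: field_simps)
  qed
  then show "Delta_approximate M z"
    using feas by (simp add: Delta_approximate_def)
qed

section \<open>Constraints that ask for one large coordinate\<close>

text \<open>The common normal form of the constraints of all three problems: floors of nonnegative
  numbers sum to at least \<open>1\<close> exactly if one of the numbers is at least
  \<open>1\<close>.\<close>

definition cover :: "'v set \<Rightarrow> 'v set \<Rightarrow> ('v \<Rightarrow> real) set" where
  "cover V U = {x \<in> orthant V. \<exists>v\<in>U. 1 \<le> x v}"

lemma floor_sum_ge_1_iff:
  assumes "finite U" and "x \<in> orthant V"
  shows "(\<Sum>v\<in>U. \<lfloor>x v\<rfloor>) \<ge> 1 \<longleftrightarrow> (\<exists>v\<in>U. 1 \<le> x v)"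
proof
  assume *: "(\<Sum>v\<in>U. \<lfloor>x v\<rfloor>) \<ge> 1"
  show "\<exists>v\<in>U. 1 \<le> x v"
  proof (rule ccontr)
    assume "\<not> ?thesis"
    then have "\<lfloor>x v\<rfloor> \<le> 0" if "v \<in> U" for v
      using that by (auto simp: floor_le_iff not_le)
    then have "(\<Sum>v\<in>U. \<lfloor>x v\<rfloor>) \<le> 0" by (rule sum_nonpos)
    then show False using * by simp
  qed
next
  assume "\<exists>v\<in>U. 1 \<le> x v"
  then obtain v where v: "v \<in> U" "1 \<le> x v" by blast
  have "\<lfloor>x v\<rfloor> \<le> (\<Sum>v\<in>U. \<lfloor>x v\<rfloor>)"
    using assms v by (intro member_le_sum) (auto intro: orthant_nonneg)
  then show "(\<Sum>v\<in>U. \<lfloor>x v\<rfloor>) \<ge> 1"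
    using v by (simp add: le_floor_iff order_trans[rotated])
qed

lemma cover_eq_floor_sum:
  "finite U \<Longrightarrow> {x \<in> orthant V. (\<Sum>v\<in>U. \<lfloor>x v\<rfloor>) \<ge> 1} = cover V U"
  unfolding cover_def using floor_sum_ge_1_iff by blast

lemma monotone_in_cover: "monotone_in V (cover V U)"
  by (auto simp: monotone_in_def cover_def le_fun_def intro: order_trans)

lemma vars_cover:
  assumes "U \<subseteq> coords M"
  shows "vars M (cover (coords M) U) = U"
proof (intro equalityI subsetI)
  fix j assume "j \<in> vars M (cover (coords M) U)"
  then obtain x t where x: "j \<in> coords M" "x \<in> orthant (coords M)" "0 \<le> t"
      "(x \<in> cover (coords M) U) \<noteq> (x(j := t) \<in> cover (coords M) U)"
    by (auto simp: vars_def)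
  then show "j \<in> U"
    using orthant_upd[OF x(2,1,3)] by (auto simp: cover_def split: if_splits)
next
  fix j assume j: "j \<in> U"
  have "(\<lambda>_. 0) \<in> orthant (coords M)" "(\<lambda>_. 0)(j := 1) \<in> orthant (coords M)"
    using assms j by (auto simp: orthant_def)
  then show "j \<in> vars M (cover (coords M) U)"
    using j assms unfolding vars_def cover_def
    by (auto intro!: bexI[of _ "\<lambda>_. 0"] exI[of _ 1])
qed

lemma Delta_cover:
  assumes "constraints M = cover (coords M) ` \<U>" and "\<And>U. U \<in> \<U> \<Longrightarrow> U \<subseteq> coords M"
  shows "Delta M = (SUP U\<in>\<U>. card U)"
  unfolding Delta_def assms(1) image_image
  by (rule SUP_cong) (simp_all add: vars_cover assms(2))

lemma floor_mem_feasible: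
  assumes "constraints M = cover (coords M) ` \<U>" and x: "x \<in> orthant (coords M)"
    and "\<And>U. U \<in> \<U> \<Longrightarrow> \<exists>v\<in>U. 1 \<le> x v"
  shows "(\<lambda>j. real_of_int \<lfloor>x j\<rfloor>) \<in> feasible M"
proof -
  have "(\<lambda>j. real_of_int \<lfloor>x j\<rfloor>) \<in> orthant (coords M)"
    using x by (auto simp: orthant_def)
  moreover have "\<exists>v\<in>U. 1 \<le> real_of_int \<lfloor>x v\<rfloor>" if "U \<in> \<U>" for U
    using assms(3)[OF that] by (auto simp: le_floor_iff)
  ultimately show ?thesis
    using assms(1) by (auto simp: feasible_def cover_def)
qed

text \<open>Reduces a step to costs of single-coordinate updates. Any point of the constraint above
  \<open>x\<close> dominates some \<open>x(v := 1)\<close>, so \<open>low\<close> bounds the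
  increment. The two alternatives of \<open>largest\<close> are the bounded and the unbounded branch
  of \<open>raised\<close>; in the latter \<open>1\<close> stands for infinity, since setting a
  coordinate to \<open>1\<close> never leaves a set of the form \<open>cover\<close>.\<close>

lemma tight_step_cover:
  assumes M: "monotone_covering M" and con: "constraints M = cover (coords M) ` \<U>"
    and U: "U \<in> \<U>" "U \<subseteq> coords M" and x: "x \<in> orthant (coords M)" and \<beta>: "0 \<le> \<beta>"
    and violated: "\<And>v. v \<in> U \<Longrightarrow> x v < 1"
    and low: "\<And>v. v \<in> U \<Longrightarrow> cost M x + \<beta> \<le> cost M (x(v := 1))"
    and up: "\<And>v. v \<in> U \<Longrightarrow> x v \<le> x' v"
    and tight: "\<And>v. v \<in> U \<Longrightarrow> cost M (x(v := x' v)) = cost M x + \<beta>"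
    and largest: "\<And>v. v \<in> U \<Longrightarrow> (\<forall>t>x' v. cost M x + \<beta> < cost M (x(v := t))) \<or>
      x' v = 1 \<and> (\<forall>t\<ge>1. cost M (x(v := t)) \<le> cost M x + \<beta>)"
    and out: "\<And>v. v \<notin> U \<Longrightarrow> x' v = x v"
  shows "tight_step M x x'"
proof -
  have "raised M \<beta> x v (x' v)" if v: "v \<in> U" for v
  proof -
    have adm: "x' v \<in> admissible M \<beta> x v"
      using up tight v by (simp add: admissible_def)
    from largest[OF v] show ?thesis
    proof
      assume *: "\<forall>t>x' v. cost M x + \<beta> < cost M (x(v := t))"
      have max: "t \<le> x' v" if "t \<in> admissible M \<beta> x v" for t
        using * that by (force simp: admissible_def not_le[symmetric])
      then have "bdd_above (admissible M \<beta> x v)" by (rule bdd_aboveI)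
      then show ?thesis using adm max by (simp add: raised_def)
    next
      assume *: "x' v = 1 \<and> (\<forall>t\<ge>1. cost M (x(v := t)) \<le> cost M x + \<beta>)"
      have "t \<in> admissible M \<beta> x v" if "1 \<le> t" for t
        using * that violated[OF v] by (auto simp: admissible_def algebra_simps)
      then have "\<not> bdd_above (admissible M \<beta> x v)"
        unfolding bdd_above_def by (metis gt_ex le_less_trans less_imp_le less_le_not_le linear)
      moreover have "y(v := 1) \<in> cover (coords M) W" if "y \<in> cover (coords M) W" for y W
        using that U v orthant_upd[of y "coords M" v 1] by (auto simp: cover_def)
      ultimately show ?thesis
        using adm * con by (auto simp: raised_def)
    qed
  qed
  moreover have "cost M x + \<beta> \<le> cost M y" if y: "y \<in> cover (coords M) U" "x \<le> y" for y
  proof -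
    from y(1) obtain v where v: "v \<in> U" "1 \<le> y v" "y \<in> orthant (coords M)"
      by (auto simp: cover_def)
    have "x(v := 1) \<le> y" using y(2) v by (auto simp: le_fun_def)
    then have "cost M (x(v := 1)) \<le> cost M y"
      using v U x by (intro monotone_coveringD(4)[OF M]) (auto intro: orthant_upd)
    then show ?thesis using low[OF v(1)] by simp
  qed
  moreover have "x \<notin> cover (coords M) U"
    using violated by (auto simp: cover_def not_le)
  moreover have "cover (coords M) U \<in> constraints M" using con U by blast
  ultimately show ?thesis
    unfolding tight_step_def using \<beta> tight out vars_cover[OF U(2)] by metis
qed

section \<open>Water levels of the facilities\<close>

text \<open>
  The largest \<open>t\<close> with \<open>d * t + f * max 0 (t - y) \<le> \<beta>\<close>; if \<open>d = f = 0\<close> every \<open>t\<close> qualifies, and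
  \<open>1\<close> is as good as infinity.
\<close>

definition level :: "real \<Rightarrow> real \<Rightarrow> real \<Rightarrow> real \<Rightarrow> real" where
  "level f d y \<beta> = (if 0 < d + f then if \<beta> < d * y then \<beta> / d else (\<beta> + f * y) / (d + f) else 1)"

text \<open>As a function of \<open>t\<close>, the expression
  \<open>d * t + f * max 0 (t - y)\<close> has slope \<open>d\<close> up to \<open>y\<close> and
  slope \<open>d + f\<close> beyond; the cases \<open>low\<close> and \<open>high\<close> tell on
  which piece it takes the value \<open>\<beta>\<close>. At \<open>t = 1\<close> it equals
  \<open>d + f * (1 - y)\<close>, so the last assumption keeps the level in the unit interval, with
  \<open>1\<close> reached at equality. In case \<open>low\<close> equality is impossible, as
  \<open>\<beta> < d\<close>.\<close>

lemma level:
  assumes "0 \<le> d" "0 \<le> f" "0 \<le> y" "y \<le> 1" "0 \<le> \<beta>" "\<beta> \<le> d + f * (1 - y)"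
  shows level_nonneg: "0 \<le> level f d y \<beta>"
    and level_le_1: "level f d y \<beta> \<le> 1"
    and level_tight: "d * level f d y \<beta> + f * max 0 (level f d y \<beta> - y) = \<beta>"
    and level_largest: "0 < d + f \<Longrightarrow> level f d y \<beta> < t \<Longrightarrow> \<beta> < d * t + f * max 0 (t - y)"
    and level_full: "\<beta> = d + f * (1 - y) \<Longrightarrow> level f d y \<beta> = 1"
proof -
  consider (zero) "d = 0" "f = 0" | (low) "0 < d" "\<beta> < d * y" | (high) "0 < d + f" "d * y \<le> \<beta>"
    using assms(1,2,3,5) by (cases "d = 0"; cases "f = 0") force+
  then have "0 \<le> level f d y \<beta> \<and> level f d y \<beta> \<le> 1 \<and>
    d * level f d y \<beta> + f * max 0 (level f d y \<beta> - y) = \<beta> \<and>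
    (\<forall>t. 0 < d + f \<longrightarrow> level f d y \<beta> < t \<longrightarrow> \<beta> < d * t + f * max 0 (t - y)) \<and>
    (\<beta> = d + f * (1 - y) \<longrightarrow> level f d y \<beta> = 1)"
  proof cases
    case zero
    then show ?thesis using assms by (simp add: level_def)
  next
    case low
    then have l: "level f d y \<beta> = \<beta> / d" "0 < d + f" using assms by (auto simp: level_def)
    have "\<beta> / d < y" using low by (simp add: field_simps)
    moreover have "\<beta> < d * t + f * max 0 (t - y)" if "\<beta> / d < t" for t
    proof -
      have "\<beta> < d * t" using that low by (simp add: field_simps)
      moreover have "0 \<le> f * max 0 (t - y)" using assms by simp
      ultimately show ?thesis by linarith
    qed
    moreover have "\<beta> < d"
      using low assms mult_left_le[of y d] by linarith
    moreover from this have "\<beta> \<noteq> d + f * (1 - y)"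
      using assms by (smt (verit) mult_nonneg_nonneg)
    ultimately show ?thesis using l low assms by auto
  next
    case high
    then have l: "level f d y \<beta> = (\<beta> + f * y) / (d + f)" by (auto simp: level_def)
    have y: "y \<le> (\<beta> + f * y) / (d + f)" using high by (simp add: field_simps)
    have "\<beta> < d * t + f * max 0 (t - y)" if "(\<beta> + f * y) / (d + f) < t" for t
    proof -
      have "y < t" using y that by linarith
      moreover have "\<beta> + f * y < t * (d + f)" using that high by (simp add: field_simps)
      ultimately show ?thesis by (simp add: algebra_simps)
    qed
    moreover have "d * ((\<beta> + f * y) / (d + f)) + f * ((\<beta> + f * y) / (d + f) - y) = \<beta>"
    proof -
      have "(d + f) * ((\<beta> + f * y) / (d + f)) = \<beta> + f * y" using high by simp
      then show ?thesis by (simp only: ring_distribs)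
    qed
    moreover have "(\<beta> + f * y) / (d + f) \<le> 1" using high assms by (simp add: field_simps)
    moreover have "(\<beta> + f * y) / (d + f) = 1" if "\<beta> = d + f * (1 - y)"
      using high that by (simp add: field_simps)
    ultimately show ?thesis using l y assms by auto
  qed
  then show "0 \<le> level f d y \<beta>" "level f d y \<beta> \<le> 1"
    "d * level f d y \<beta> + f * max 0 (level f d y \<beta> - y) = \<beta>"
    "0 < d + f \<Longrightarrow> level f d y \<beta> < t \<Longrightarrow> \<beta> < d * t + f * max 0 (t - y)"
    "\<beta> = d + f * (1 - y) \<Longrightarrow> level f d y \<beta> = 1"
    by auto
qed

locale location =
  fixes m :: nat and N :: "nat \<Rightarrow> nat set" and f :: "nat \<Rightarrow> real" and d :: "nat \<Rightarrow> nat \<Rightarrow> real"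
  assumes finite_N: "i < m \<Longrightarrow> finite (N i)" and N_nonempty: "i < m \<Longrightarrow> N i \<noteq> {}"
    and f_nonneg: "i < m \<Longrightarrow> j \<in> N i \<Longrightarrow> 0 \<le> f j"
    and d_nonneg: "i < m \<Longrightarrow> j \<in> N i \<Longrightarrow> 0 \<le> d i j"
begin

definition price :: "(nat \<Rightarrow> real) \<Rightarrow> nat \<Rightarrow> nat \<Rightarrow> real" where
  "price y i j = d i j + f j * (1 - y j)"

definition bid :: "(nat \<Rightarrow> real) \<Rightarrow> nat \<Rightarrow> real" where
  "bid y i = Min (price y i ` N i)"

definition raise_to :: "(nat \<Rightarrow> real) \<Rightarrow> nat \<Rightarrow> nat \<Rightarrow> real" where
  "raise_to y i j = level (f j) (d i j) (y j) (bid y i)"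

text \<open>
  Facility location would allow raising free facilities regardless of whether the customer is
  already covered; set cover does not, since there the step is not performed at all.
\<close>

definition next_levels :: "(nat \<Rightarrow> real) \<Rightarrow> nat \<Rightarrow> nat \<Rightarrow> real" where
  "next_levels y i j =
     (if j \<in> N i \<and> (0 < d i j + f j \<or> (\<forall>j\<in>N i. y j < 1)) then max (y j) (raise_to y i j) else y j)"

primrec levels :: "nat \<Rightarrow> nat \<Rightarrow> real" where
  "levels 0 = (\<lambda>_. 0)"
| "levels (Suc i) = next_levels (levels i) i"

lemma bid_le_price: "i < m \<Longrightarrow> j \<in> N i \<Longrightarrow> bid y i \<le> price y i j"
  by (simp add: bid_def finite_N)

lemma bid_eq_price: "i < m \<Longrightarrow> \<exists>j\<in>N i. bid y i = price y i j"
  using Min_in[of "price y i ` N i"] finite_N[of i] N_nonempty[of i] unfolding bid_def by blast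

context
  fixes y :: "nat \<Rightarrow> real" and i :: nat
  assumes i: "i < m" and y0: "\<And>j. 0 \<le> y j" and y1: "\<And>j. y j \<le> 1"
begin

lemma bid_nonneg: "0 \<le> bid y i"
  using bid_eq_price[OF i, of y] d_nonneg[OF i] f_nonneg[OF i] y1 by (force simp: price_def)

lemma raise_to_props:
  assumes "j \<in> N i"
  shows raise_to_nonneg: "0 \<le> raise_to y i j"
    and raise_to_le_1: "raise_to y i j \<le> 1"
    and raise_to_tight: "d i j * raise_to y i j + f j * max 0 (raise_to y i j - y j) = bid y i"
    and raise_to_largest: "0 < d i j + f j \<Longrightarrow> raise_to y i j < t \<Longrightarrow>
      bid y i < d i j * t + f j * max 0 (t - y j)"
    and raise_to_full: "bid y i = price y i j \<Longrightarrow> raise_to y i j = 1"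
  using level[OF d_nonneg[OF i assms] f_nonneg[OF i assms] y0 y1 bid_nonneg]
    bid_le_price[OF i assms, of y]
  unfolding raise_to_def price_def by blast+

lemma ex_raise_to_full: "\<exists>j\<in>N i. raise_to y i j = 1"
  using bid_eq_price[OF i, of y] raise_to_full by blast

end

lemma raise_to_free: "\<not> 0 < d i j + f j \<Longrightarrow> raise_to y i j = 1"
  by (simp add: raise_to_def level_def)

lemma levels_bounds: "i \<le> m \<Longrightarrow> 0 \<le> levels i j \<and> levels i j \<le> 1"
proof (induction i arbitrary: j)
  case (Suc i)
  then show ?case
    using raise_to_le_1[of i "levels i" j] by (auto simp: next_levels_def le_max_iff_disj)
qed simp

lemma levels_nonneg: "i \<le> m \<Longrightarrow> 0 \<le> levels i j" and levels_le_1: "i \<le> m \<Longrightarrow> levels i j \<le> 1"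
  using levels_bounds by blast+

lemma levels_mono: "i \<le> i' \<Longrightarrow> levels i j \<le> levels i' j"
  by (rule lift_Suc_mono_le[of "\<lambda>i. levels i j"]) (auto simp: next_levels_def)

lemma levels_outside: "(\<And>i'. i' < i \<Longrightarrow> j \<notin> N i') \<Longrightarrow> levels i j = 0"
  by (induction i) (auto simp: next_levels_def)

lemma levels_raise_to_bounds:
  assumes "i < m" "j \<in> N i"
  shows "0 \<le> raise_to (levels i) i j" "raise_to (levels i) i j \<le> 1"
  using assms levels_nonneg[of i] levels_le_1[of i]
  by (auto intro!: raise_to_nonneg raise_to_le_1)

end

lemma floor_unit_interval: "0 \<le> (t::real) \<Longrightarrow> t \<le> 1 \<Longrightarrow> real_of_int \<lfloor>t\<rfloor> = (if t < 1 then 0 else 1)"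
  by (auto simp: floor_eq_iff)

section \<open>Linear costs\<close>

definition linear_covering :: "'v set \<Rightarrow> ('v \<Rightarrow> real) \<Rightarrow> 'v set set \<Rightarrow> 'v covering" where
  "linear_covering V c \<U> = \<lparr>coords = V, cost = (\<lambda>x. \<Sum>v\<in>V. c v * x v), constraints = cover V ` \<U>\<rparr>"

lemma linear_covering_simps [simp]:
  "coords (linear_covering V c \<U>) = V"
  "cost (linear_covering V c \<U>) x = (\<Sum>v\<in>V. c v * x v)"
  "constraints (linear_covering V c \<U>) = cover V ` \<U>"
  by (simp_all add: linear_covering_def)

lemma inf_add_sup_real: "inf a b + sup a b = a + (b::real)"
  by (simp add: inf_real_def sup_real_def)

lemma monotone_covering_linear:
  assumes "finite V" and c: "\<And>v. v \<in> V \<Longrightarrow> 0 \<le> c v"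
  shows "monotone_covering (linear_covering V c \<U>)"
  unfolding monotone_covering_def linear_covering_simps
proof (intro conjI ballI impI)
  fix x y :: "'a \<Rightarrow> real"
  have "(\<Sum>v\<in>V. c v * inf x y v) + (\<Sum>v\<in>V. c v * sup x y v) = (\<Sum>v\<in>V. c v * x v) + (\<Sum>v\<in>V. c v * y v)"
    unfolding sum.distrib[symmetric] ring_distribs(1)[symmetric] inf_fun_def sup_fun_def
      inf_add_sup_real ..
  then show "(\<Sum>v\<in>V. c v * inf x y v) + (\<Sum>v\<in>V. c v * sup x y v) \<le>
      (\<Sum>v\<in>V. c v * x v) + (\<Sum>v\<in>V. c v * y v)" by simp
qed (use assms monotone_in_cover in \<open>auto intro!: sum_nonneg sum_mono mult_left_mono simp: orthant_def le_fun_def\<close>)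

lemma linear_cost_upd:
  assumes "finite V" "v \<in> V"
  shows "(\<Sum>u\<in>V. c u * (x(v := t)) u) = (\<Sum>u\<in>V. c u * x u) + c v * (t - x v :: real)"
  using assms by (simp add: sum.remove[of V v] algebra_simps)

lemma Delta_linear: "(\<And>U. U \<in> \<U> \<Longrightarrow> U \<subseteq> V) \<Longrightarrow> Delta (linear_covering V c \<U>) = (SUP U\<in>\<U>. card U)"
  by (rule Delta_cover) auto

text \<open>If the constraint of \<open>i\<close> is violated, passing to the next levels is a tight
  step. Otherwise some \<open>j\<close> in \<open>N i\<close> has level \<open>1\<close>, hence
  price \<open>0\<close>, so the bid is \<open>0\<close>: members of positive cost keep their levels
  by the formula, and the test in \<open>next_levels\<close> holds back those of cost zero. Since
  levels never fall, constraints once satisfied stay so.\<close>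

lemma linear_levels_tight_run:
  assumes V: "finite V" "\<And>v. v \<in> V \<Longrightarrow> 0 \<le> f v"
    and N: "\<And>i. i < m \<Longrightarrow> N i \<subseteq> V" "\<And>i. i < m \<Longrightarrow> N i \<noteq> {}" and i: "i \<le> m"
  shows "(tight_step (linear_covering V f (N ` {..<m})))\<^sup>*\<^sup>* (\<lambda>_. 0) (location.levels N f (\<lambda>_ _. 0) i)"
    and "i' < i \<Longrightarrow> \<exists>j\<in>N i'. 1 \<le> location.levels N f (\<lambda>_ _. 0) i j"
proof -
  interpret location m N f "\<lambda>_ _. 0"
    using V N by unfold_locales (auto intro: finite_subset)
  define M where "M = linear_covering V f (N ` {..<m})"
  have M: "monotone_covering M"
    unfolding M_def using V by (rule monotone_covering_linear)
  have orth: "levels i \<in> orthant V" if "i \<le> m" for i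
    using that N(1) by (intro orthantI levels_nonneg levels_outside) (auto dest: less_le_trans)
  have step: "levels (Suc i) = levels i \<or> tight_step M (levels i) (levels (Suc i))"
    and cov: "\<exists>j\<in>N i. 1 \<le> levels (Suc i) j" if i: "i < m" for i
  proof -
    note y0 = levels_nonneg[OF less_imp_le[OF i]] and y1 = levels_le_1[OF less_imp_le[OF i]]
    note props = raise_to_props[of i "levels i", OF i y0 y1, simplified]
    have fn: "0 \<le> f j" if "j \<in> N i" for j using f_nonneg[OF i that] .
    have "(levels (Suc i) = levels i \<or> tight_step M (levels i) (levels (Suc i))) \<and>
      (\<exists>j\<in>N i. 1 \<le> levels (Suc i) j)"
    proof (cases "\<forall>j\<in>N i. levels i j < 1")
      case True
      let ?y = "levels i" and ?y' = "levels (Suc i)"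
      have y': "?y' j = raise_to ?y i j" if "j \<in> N i" for j
      proof -
        have "?y j \<le> raise_to ?y i j"
        proof (cases "f j = 0")
          case True
          then show ?thesis using y1 raise_to_free[of j ?y i] by simp
        next
          case False
          then have "0 < f j" using fn[OF that] by simp
          \<comment> \<open>Were the new value below \<open>?y j\<close>, then
            \<open>props(4)\<close> at \<open>t = ?y j\<close> would make the bid negative.\<close>
          then show ?thesis
            using props(4)[OF that, of "?y j"] bid_nonneg[of i "levels i", OF i y0 y1] by force
        qed
        then show ?thesis using True that by (simp add: next_levels_def)
      qed
      have eq: "f j * (?y' j - ?y j) = bid ?y i" if "j \<in> N i" for j
        using props(3)[OF that] y'[OF that] levels_mono[of i "Suc i" j] by (simp add: max_def)
      have "tight_step M ?y ?y'"
      proof (rule tight_step_cover[OF M, of "N ` {..<m}" "N i" _ "bid ?y i"])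
        fix v assume v: "v \<in> N i"
        have vV: "v \<in> V" using v N i by blast
        note upd = linear_cost_upd[OF V(1) vV]
        show "cost M ?y + bid ?y i \<le> cost M (?y(v := 1))"
          using bid_le_price[OF i v, of ?y] by (simp add: M_def upd price_def del: fun_upd_apply)
        show "cost M (?y(v := ?y' v)) = cost M ?y + bid ?y i"
          using eq[OF v] by (simp add: M_def upd del: fun_upd_apply levels.simps)
        show "(\<forall>t>?y' v. cost M ?y + bid ?y i < cost M (?y(v := t))) \<or>
          ?y' v = 1 \<and> (\<forall>t\<ge>1. cost M (?y(v := t)) \<le> cost M ?y + bid ?y i)"
        proof (cases "f v = 0")
          case True
          then have "?y' v = 1" using raise_to_free[of v ?y i] y'[OF v] by simp
          then show ?thesis
            using True bid_nonneg[of i "levels i", OF i y0 y1] by (simp add: M_def upd del: fun_upd_apply levels.simps)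
        next
          case False
          then have "0 < f v" using fn[OF v] by simp
          then have "bid ?y i < f v * (t - ?y v)" if "?y' v < t" for t
            using that unfolding eq[OF v, symmetric] by simp
          then show ?thesis by (simp add: M_def upd del: fun_upd_apply levels.simps)
        qed
      qed (use i N orth True bid_nonneg[of i "levels i", OF i y0 y1] in
          \<open>auto simp: M_def next_levels_def\<close>)
      moreover have "\<exists>j\<in>N i. ?y' j = 1"
        using ex_raise_to_full[of i "levels i", OF i y0 y1] y' by auto
      ultimately show ?thesis by force
    next
      case False
      then obtain j where j: "j \<in> N i" "1 \<le> levels i j" by (auto simp: not_less)
      have "price (levels i) i j = 0" using j(2) y1[of j] by (simp add: price_def)
      then have "bid (levels i) i = 0"
        using bid_le_price[OF i j(1), of "levels i"] bid_nonneg[of i "levels i", OF i y0 y1] by linarith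
      then have "raise_to (levels i) i j = levels i j" if "0 < f j" for j
        using that by (simp add: raise_to_def level_def)
      then have "levels (Suc i) = levels i"
        using False by (auto simp: next_levels_def fun_eq_iff)
      then show ?thesis using j by auto
    qed
    then show "levels (Suc i) = levels i \<or> tight_step M (levels i) (levels (Suc i))"
      "\<exists>j\<in>N i. 1 \<le> levels (Suc i) j" by blast+
  qed
  have "(tight_step M)\<^sup>*\<^sup>* (\<lambda>_. 0) (levels i)"
    using i
  proof (induction i)
    case (Suc i)
    then have "(tight_step M)\<^sup>*\<^sup>* (\<lambda>_. 0) (levels i)" "i < m" by simp_all
    with step[of i] show ?case by (metis rtranclp.rtrancl_into_rtrancl)
  qed simp
  then show "(tight_step (linear_covering V f (N ` {..<m})))\<^sup>*\<^sup>* (\<lambda>_. 0) (levels i)"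
    by (simp add: M_def)
  show "\<exists>j\<in>N i'. 1 \<le> levels i j" if "i' < i"
  proof -
    have "i' < m" using that i by simp
    from cov[OF this] obtain j where "j \<in> N i'" "1 \<le> levels (Suc i') j" by blast
    moreover have "levels (Suc i') j \<le> levels i j"
      using that by (intro levels_mono) simp
    ultimately show ?thesis by (meson order_trans)
  qed
qed

definition cover_solution :: "nat \<Rightarrow> (nat \<Rightarrow> nat set) \<Rightarrow> (nat \<Rightarrow> real) \<Rightarrow> nat \<Rightarrow> real" where
  "cover_solution m N f j = (if location.levels N f (\<lambda>_ _. 0) m j < 1 then 0 else 1)"

lemma linear_levels_result:
  assumes V: "finite V" "\<And>v. v \<in> V \<Longrightarrow> 0 \<le> f v"
    and N: "\<And>i. i < m \<Longrightarrow> N i \<subseteq> V" "\<And>i. i < m \<Longrightarrow> N i \<noteq> {}"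
  defines "z \<equiv> cover_solution m N f"
    and "M \<equiv> linear_covering V f (N ` {..<m})"
  shows "greedy_result M z \<and> Delta_approximate M z"
proof -
  interpret location m N f "\<lambda>_ _. 0"
    using V N by unfold_locales (auto intro: finite_subset)
  have orth: "levels m \<in> orthant (coords M)"
    using N(1) by (auto intro!: orthantI levels_nonneg levels_outside simp: M_def)
  have z: "z = (\<lambda>j. real_of_int \<lfloor>levels m j\<rfloor>)"
    by (simp add: z_def cover_solution_def fun_eq_iff floor_unit_interval levels_nonneg levels_le_1)
  have "z \<in> feasible M"
    unfolding z using linear_levels_tight_run(2)[OF V N order_refl]
    by (intro floor_mem_feasible[of _ "N ` {..<m}"] orth) (auto simp: M_def)
  then show ?thesis
    using linear_levels_tight_run(1)[OF V N order_refl]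
    by (intro Delta_approximate_tight_run[OF _ _ _ orth z])
      (auto simp: M_def intro: monotone_covering_linear V)
qed

section \<open>Costs of facility location\<close>

definition peak :: "'a set \<Rightarrow> ('a \<Rightarrow> real) \<Rightarrow> real" where
  "peak A h = Max (insert 0 (h ` A))"

lemma peak_nonneg: "finite A \<Longrightarrow> 0 \<le> peak A h"
  by (simp add: peak_def)

lemma peak_upper: "finite A \<Longrightarrow> i \<in> A \<Longrightarrow> h i \<le> peak A h"
  by (simp add: peak_def)

lemma peak_least: "finite A \<Longrightarrow> 0 \<le> b \<Longrightarrow> (\<And>i. i \<in> A \<Longrightarrow> h i \<le> b) \<Longrightarrow> peak A h \<le> b"
  by (auto simp: peak_def)

lemma peak_mono: "finite A \<Longrightarrow> (\<And>i. i \<in> A \<Longrightarrow> g i \<le> h i) \<Longrightarrow> peak A g \<le> peak A h"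
  by (intro peak_least peak_nonneg) (auto intro: order_trans peak_upper)

lemma peak_zero: "finite A \<Longrightarrow> peak A (\<lambda>_. 0) = 0"
  by (simp add: antisym peak_least peak_nonneg)

lemma peak_upd:
  assumes "finite A" "i \<in> A" "0 \<le> t" "h i \<le> t"
  shows "peak A (h(i := t)) = max (peak A h) t"
proof (rule antisym)
  show "peak A (h(i := t)) \<le> max (peak A h) t"
    using assms by (intro peak_least) (auto simp: le_max_iff_disj peak_upper)
  have "peak A h \<le> peak A (h(i := t))"
    using assms by (intro peak_mono) auto
  moreover have "t \<le> peak A (h(i := t))"
    using peak_upper[of A i "h(i := t)"] assms by simp
  ultimately show "max (peak A h) t \<le> peak A (h(i := t))" by simp
qed

text \<open>The peak of the infimum is at most the minimum of the two peaks, that of the supremum at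
  most their maximum, and minimum plus maximum is the sum.\<close>

lemma peak_submodular:
  assumes "finite A"
  shows "peak A (\<lambda>i. inf (g i) (h i)) + peak A (\<lambda>i. sup (g i) (h i)) \<le> peak A g + peak A h"
proof -
  have "peak A (\<lambda>i. inf (g i) (h i)) \<le> min (peak A g) (peak A h)"
    using assms by (auto intro!: peak_mono)
  moreover have "peak A (\<lambda>i. sup (g i) (h i)) \<le> max (peak A g) (peak A h)"
    using assms by (intro peak_least)
      (auto simp: sup_real_def le_max_iff_disj[of 0] peak_nonneg intro: max.coboundedI1 max.coboundedI2 peak_upper)
  ultimately show ?thesis by linarith
qed

definition customers_of :: "facility_instance \<Rightarrow> nat \<Rightarrow> nat set" where
  "customers_of I j = {i. i < customers I \<and> j \<in> serving I i}"

definition fl_coords :: "facility_instance \<Rightarrow> (nat \<times> nat) set" where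
  "fl_coords I = Sigma {..<customers I} (serving I)"

lemma finite_customers_of [simp]: "finite (customers_of I j)"
  by (simp add: customers_of_def)

section \<open>Facility location as a monotone covering instance\<close>

context
  fixes I :: facility_instance
  assumes I: "facility_location I"
begin

lemma serving_props:
  assumes "i < customers I"
  shows "finite (serving I i)" "serving I i \<noteq> {}" "serving I i \<subseteq> {..<facilities I}"
  using I assms by (auto simp: facility_location_def intro: finite_subset[OF _ finite_lessThan])

lemma location_facility:
  "location (customers I) (serving I) (opening_cost I) (service_cost I)"
  using I serving_props by unfold_locales (auto simp: facility_location_def subset_iff)

lemma finite_fl_coords: "finite (fl_coords I)"
  unfolding fl_coords_def by (intro finite_SigmaI) (auto simp: serving_props)

text \<open>Separates the opening costs, expressed by peaks, from a linear function of the pairs, so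
  that the facts on \<open>linear_covering\<close> and \<open>cover\<close> can be reused.\<close>

lemma fl_covering_simps:
  "coords (fl_covering I) = fl_coords I"
  "cost (fl_covering I) x =
     (\<Sum>j<facilities I. opening_cost I j * peak (customers_of I j) (\<lambda>i. x (i, j))) +
     (\<Sum>v\<in>fl_coords I. case_prod (service_cost I) v * x v)"
  "constraints (fl_covering I) = cover (fl_coords I) ` (\<lambda>i. Pair i ` serving I i) ` {..<customers I}"
proof -
  show "coords (fl_covering I) = fl_coords I"
    by (simp add: fl_covering_def fl_coords_def)
  have "(\<Sum>i<customers I. \<Sum>j\<in>serving I i. service_cost I i j * x (i, j)) =
      (\<Sum>v\<in>fl_coords I. case_prod (service_cost I) v * x v)"
    unfolding fl_coords_def
    by (subst sum.Sigma) (auto simp: serving_props intro!: sum.cong)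
  then show "cost (fl_covering I) x =
     (\<Sum>j<facilities I. opening_cost I j * peak (customers_of I j) (\<lambda>i. x (i, j))) +
     (\<Sum>v\<in>fl_coords I. case_prod (service_cost I) v * x v)"
    by (simp add: fl_covering_def peak_def customers_of_def)
  have "{x \<in> orthant (fl_coords I). (\<Sum>j\<in>serving I i. \<lfloor>x (i, j)\<rfloor>) \<ge> 1} =
      cover (fl_coords I) (Pair i ` serving I i)" if "i < customers I" for i
    using cover_eq_floor_sum[of "Pair i ` serving I i" "fl_coords I"] serving_props[OF that]
    by (simp add: sum.reindex inj_on_def)
  then show "constraints (fl_covering I) =
      cover (fl_coords I) ` (\<lambda>i. Pair i ` serving I i) ` {..<customers I}"
    unfolding fl_covering_def image_image fl_coords_def[symmetric] by simp
qed

lemma monotone_covering_fl: "monotone_covering (fl_covering I)"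
proof -
  let ?P = "\<lambda>x. \<Sum>j<facilities I. opening_cost I j * peak (customers_of I j) (\<lambda>i. x (i, j))"
  have d: "0 \<le> case_prod (service_cost I) v" if "v \<in> fl_coords I" for v
    using that I by (auto simp: fl_coords_def facility_location_def)
  have f: "0 \<le> opening_cost I j" if "j \<in> {..<facilities I}" for j
    using that I by (auto simp: facility_location_def)
  have nonneg: "0 \<le> ?P x" for x
    using f by (intro sum_nonneg mult_nonneg_nonneg peak_nonneg) auto
  have mono: "?P x \<le> ?P y" if "x \<le> y" for x y
    using f that by (intro sum_mono mult_left_mono peak_mono) (auto simp: le_fun_def)
  have sub: "?P (inf x y) + ?P (sup x y) \<le> ?P x + ?P y" for x y
    unfolding sum.distrib[symmetric] ring_distribs(1)[symmetric]
    using f peak_submodular[OF finite_customers_of] by (intro sum_mono mult_left_mono) auto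
  \<comment> \<open>A covering without constraints, introduced to inherit nonnegativity,
    monotonicity and submodularity of its linear cost.\<close>
  have lin: "monotone_covering (linear_covering (fl_coords I) (case_prod (service_cost I)) {})"
    using finite_fl_coords d by (rule monotone_covering_linear)
  have nonneg': "0 \<le> (\<Sum>v\<in>fl_coords I. case_prod (service_cost I) v * x v)" if "x \<in> orthant (fl_coords I)" for x
    using lin that unfolding monotone_covering_def linear_covering_simps by blast
  note mono' = monotone_coveringD(4)[OF lin, unfolded linear_covering_simps]
  note sub' = monotone_coveringD(5)[OF lin, unfolded linear_covering_simps]
  show ?thesis
    unfolding monotone_covering_def fl_covering_simps
  proof (intro conjI ballI impI)
    fix x y :: "nat \<times> nat \<Rightarrow> real"
    assume xy: "x \<in> orthant (fl_coords I)" "y \<in> orthant (fl_coords I)"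
    show "?P (inf x y) + (\<Sum>v\<in>fl_coords I. case_prod (service_cost I) v * inf x y v) +
        (?P (sup x y) + (\<Sum>v\<in>fl_coords I. case_prod (service_cost I) v * sup x y v)) \<le>
        ?P x + (\<Sum>v\<in>fl_coords I. case_prod (service_cost I) v * x v) +
        (?P y + (\<Sum>v\<in>fl_coords I. case_prod (service_cost I) v * y v))"
      using sub[of x y] sub'[OF xy] by linarith
    assume "x \<le> y"
    then show "?P x + (\<Sum>v\<in>fl_coords I. case_prod (service_cost I) v * x v) \<le>
        ?P y + (\<Sum>v\<in>fl_coords I. case_prod (service_cost I) v * y v)"
      using mono mono' xy by (intro add_mono)
  next
    fix x assume "x \<in> orthant (fl_coords I)"
    then show "0 \<le> ?P x + (\<Sum>v\<in>fl_coords I. case_prod (service_cost I) v * x v)"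
      using nonneg nonneg' by (intro add_nonneg_nonneg)
  qed (use finite_fl_coords monotone_in_cover in blast)+
qed

lemma Pair_serving_subset: "i < customers I \<Longrightarrow> Pair i ` serving I i \<subseteq> fl_coords I"
  by (auto simp: fl_coords_def)

lemma Delta_fl: "Delta (fl_covering I) = (SUP i\<in>{..<customers I}. card (serving I i))"
proof -
  have "Delta (fl_covering I) = (SUP U\<in>(\<lambda>i. Pair i ` serving I i) ` {..<customers I}. card U)"
    using Pair_serving_subset by (intro Delta_cover) (auto simp: fl_covering_simps)
  then show ?thesis by (simp add: image_image card_image inj_on_def)
qed

text \<open>As the old value is \<open>0\<close>, the peak of facility \<open>j\<close> becomes the
  maximum of the old peak and \<open>t\<close>. Only the part of \<open>t\<close> above the old peak
  is paid for opening, which is the origin of the formula solved by \<open>level\<close>.\<close>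

lemma fl_cost_upd:
  assumes i: "i < customers I" "j \<in> serving I i" and x: "x (i, j) = 0" and t: "0 \<le> t"
  shows "cost (fl_covering I) (x((i, j) := t)) = cost (fl_covering I) x +
    (service_cost I i j * t + opening_cost I j * max 0 (t - peak (customers_of I j) (\<lambda>i. x (i, j))))"
proof -
  have j: "j < facilities I" using serving_props(3)[OF i(1)] i by auto
  let ?x = "x((i, j) := t)" and ?p = "\<lambda>x k. opening_cost I k * peak (customers_of I k) (\<lambda>i. x (i, k))"
  let ?r = "opening_cost I j * max 0 (t - peak (customers_of I j) (\<lambda>i. x (i, j)))"
  have "(\<lambda>i'. ?x (i', j)) = (\<lambda>i'. x (i', j))(i := t)"
    by auto
  then have "peak (customers_of I j) (\<lambda>i'. ?x (i', j)) =
      max (peak (customers_of I j) (\<lambda>i. x (i, j))) t"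
    using i x t by (simp only:) (intro peak_upd, auto simp: customers_of_def)
  then have pj: "?p ?x j = ?p x j + ?r"
    by (simp add: max_def algebra_simps del: fun_upd_apply)
  have "(\<Sum>k\<in>{..<facilities I} - {j}. ?p ?x k) = (\<Sum>k\<in>{..<facilities I} - {j}. ?p x k)"
    by (intro sum.cong) auto
  then have "(\<Sum>k<facilities I. ?p ?x k) = (\<Sum>k<facilities I. ?p x k) + ?r"
    using j pj by (simp add: sum.remove[of "{..<facilities I}" j] del: fun_upd_apply)
  moreover have "(i, j) \<in> fl_coords I" using i by (simp add: fl_coords_def)
  note linear_cost_upd[OF finite_fl_coords this, of "case_prod (service_cost I)" x t]
  ultimately show ?thesis
    using x by (simp add: fl_covering_simps del: fun_upd_apply)
qed

lemma fl_levels_result: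
  defines "z \<equiv> \<lambda>(i, j). if i < customers I \<and> j \<in> serving I i \<and>
    1 \<le> location.raise_to (serving I) (opening_cost I) (service_cost I)
      (location.levels (serving I) (opening_cost I) (service_cost I) i) i j then 1 else 0"
  shows "greedy_result (fl_covering I) z \<and> Delta_approximate (fl_covering I) z"
proof -
  let ?m = "customers I" and ?N = "serving I" and ?f = "opening_cost I" and ?d = "service_cost I"
  let ?M = "fl_covering I"
  interpret location ?m ?N ?f ?d by (rule location_facility)
  \<comment> \<open>The point after \<open>i\<close> customers. Customer \<open>a\<close> uses the
    levels at its own turn; later customers leave its variables alone, because the constraint of a
    customer involves only that customer's pairs.\<close>
  define X where "X i = (\<lambda>(a, b). if a < i \<and> b \<in> ?N a then raise_to (levels a) a b else 0)" for i
  have X: "X i (a, b) = (if a < i \<and> b \<in> ?N a then raise_to (levels a) a b else 0)" for i a b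
    by (simp add: X_def)
  have orth: "X i \<in> orthant (coords ?M)" if "i \<le> ?m" for i
    using that levels_raise_to_bounds
    by (auto simp: orthant_def X_def fl_covering_simps fl_coords_def)
  \<comment> \<open>For \<open>?f j = 0\<close> peak and level may differ, since
    \<open>next_levels\<close> does not raise a free facility for a customer that already sees a
    level of \<open>1\<close>. In the cost this peak carries the factor \<open>0\<close>.\<close>
  have peak: "peak (customers_of I j) (\<lambda>a. X i (a, j)) = levels i j" if "0 < ?f j" "i \<le> ?m" for i j
    using that(2)
  proof (induction i)
    case 0
    show ?case
      by (simp add: X peak_zero)
  next
    case (Suc i)
    then have i: "i < ?m" by simp
    show ?case
    proof (cases "j \<in> ?N i")
      case True
      have "(\<lambda>a. X (Suc i) (a, j)) = (\<lambda>a. X i (a, j))(i := raise_to (levels i) i j)"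
        using True by (auto simp: X)
      then have "peak (customers_of I j) (\<lambda>a. X (Suc i) (a, j)) = max (levels i j) (raise_to (levels i) i j)"
        using True i Suc levels_raise_to_bounds[OF i True]
        by (simp add: peak_upd customers_of_def X)
      moreover have "0 < ?d i j + ?f j"
        using that d_nonneg[OF i True] by simp
      ultimately show ?thesis using True by (simp add: next_levels_def)
    next
      case False
      then have "(\<lambda>a. X (Suc i) (a, j)) = (\<lambda>a. X i (a, j))"
        by (auto simp: X fun_eq_iff less_Suc_eq)
      then show ?thesis using False Suc by (simp add: next_levels_def)
    qed
  qed
  \<comment> \<open>Unlike in set cover, every customer makes a step: its own variables are still
    \<open>0\<close>, so its constraint is violated however high the levels are.\<close>
  have step: "tight_step ?M (X i) (X (Suc i))" if i: "i < ?m" for i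
  proof -
    note y0 = levels_nonneg[OF less_imp_le[OF i]] and y1 = levels_le_1[OF less_imp_le[OF i]]
    note props = raise_to_props[of i "levels i", OF i y0 y1]
    note \<beta> = bid_nonneg[of i "levels i", OF i y0 y1]
    have cost: "cost ?M ((X i)((i, j) := t)) = cost ?M (X i) + (?d i j * t + ?f j * max 0 (t - levels i j))"
      if "j \<in> ?N i" "0 \<le> t" for j t
    proof -
      have "?f j * max 0 (t - peak (customers_of I j) (\<lambda>a. X i (a, j))) = ?f j * max 0 (t - levels i j)"
        using peak[of j i] f_nonneg[OF i that(1)] i by (cases "?f j = 0") auto
      then show ?thesis
        using fl_cost_upd[OF i that(1) _ that(2), of "X i"] by (simp add: X del: fun_upd_apply)
    qed
    show ?thesis
    proof (rule tight_step_cover[OF monotone_covering_fl,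
          of "(\<lambda>i. Pair i ` ?N i) ` {..<?m}" "Pair i ` ?N i" _ "bid (levels i) i"])
      fix v assume "v \<in> Pair i ` ?N i"
      then obtain j where v: "v = (i, j)" and j: "j \<in> ?N i" by blast
      have X': "X (Suc i) v = raise_to (levels i) i j" and X0: "X i v = 0" using j by (simp_all add: X v)
      show "X i v < 1" by (simp add: X0)
      show "X i v \<le> X (Suc i) v" unfolding X' X0 by (rule props(1)[OF j])
      show "cost ?M (X i) + bid (levels i) i \<le> cost ?M ((X i)(v := 1))"
        using bid_le_price[OF i j, of "levels i"] y1[of j]
        by (simp add: v cost[OF j] price_def del: fun_upd_apply)
      show "cost ?M ((X i)(v := X (Suc i) v)) = cost ?M (X i) + bid (levels i) i"
        unfolding X' unfolding v using props(1,3)[OF j] by (simp add: cost[OF j] del: fun_upd_apply)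
      show "(\<forall>t>X (Suc i) v. cost ?M (X i) + bid (levels i) i < cost ?M ((X i)(v := t))) \<or>
        X (Suc i) v = 1 \<and> (\<forall>t\<ge>1. cost ?M ((X i)(v := t)) \<le> cost ?M (X i) + bid (levels i) i)"
      proof (cases "0 < ?d i j + ?f j")
        case True
        then show ?thesis
          using props(1)[OF j] props(4)[OF j True] unfolding X' unfolding v
          by (auto simp: cost[OF j] simp del: fun_upd_apply)
      next
        case False
        then have "?d i j = 0" "?f j = 0"
          using d_nonneg[OF i j] f_nonneg[OF i j] by linarith+
        then show ?thesis
          using raise_to_free[OF False] \<beta> unfolding X' unfolding v
          by (auto simp: cost[OF j] simp del: fun_upd_apply)
      qed
    next
      fix v assume "v \<notin> Pair i ` ?N i"
      then show "X (Suc i) v = X i v" by (cases v) (auto simp: X less_Suc_eq)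
    qed (use i orth \<beta> Pair_serving_subset in \<open>auto simp: fl_covering_simps\<close>)
  qed
  have run: "(tight_step ?M)\<^sup>*\<^sup>* (\<lambda>_. 0) (X i)" if "i \<le> ?m" for i
    using that
  proof (induction i)
    case 0
    then show ?case by (simp add: X_def case_prod_beta)
  next
    case (Suc i)
    then show ?case using step[of i] by (simp add: rtranclp.rtrancl_into_rtrancl)
  qed
  have z: "z = (\<lambda>v. real_of_int \<lfloor>X ?m v\<rfloor>)"
    using floor_unit_interval levels_raise_to_bounds by (auto simp: z_def X_def fun_eq_iff)
  have "\<exists>v\<in>Pair i ` ?N i. 1 \<le> X ?m v" if "i < ?m" for i
  proof -
    obtain j where "j \<in> ?N i" "raise_to (levels i) i j = 1"
      using ex_raise_to_full[of i "levels i"] \<open>i < ?m\<close> levels_nonneg[of i] levels_le_1[of i] by auto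
    then show ?thesis using that by (intro bexI[of _ "(i, j)"]) (auto simp: X)
  qed
  then have "z \<in> feasible ?M"
    unfolding z by (intro floor_mem_feasible orth) (auto simp: fl_covering_simps)
  moreover have "cost ?M (\<lambda>_. 0) = 0"
    by (simp add: fl_covering_simps peak_zero)
  ultimately show ?thesis
    by (intro Delta_approximate_tight_run[OF monotone_covering_fl _ run _ z] orth) auto
qed

end

section \<open>Running times of programs\<close>

text \<open>A total correctness triple with a time bound. It asserts that some halting execution
  exists, as \<open>linear_time_greedy\<close> demands.\<close>

definition runs :: "com \<Rightarrow> memory \<Rightarrow> nat \<Rightarrow> (memory \<Rightarrow> bool) \<Rightarrow> bool" where
  "runs p s T Q \<longleftrightarrow> (\<exists>t s'. exec p s t s' \<and> t \<le> T \<and> Q s')"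

lemma runs_mono: "runs p s T Q \<Longrightarrow> T \<le> T' \<Longrightarrow> (\<And>s'. Q s' \<Longrightarrow> Q' s') \<Longrightarrow> runs p s T' Q'"
  unfolding runs_def by (meson order_trans)

lemma runs_Seq: "runs p s T (\<lambda>s'. runs q s' T' Q) \<Longrightarrow> runs (Seq p q) s (T + T') Q"
  unfolding runs_def by (meson add_mono exec.Seq)

text \<open>The bound \<open>T k\<close> may vary with the iteration. Summing it over the customers
  makes the nested loops linear in the total length of the blocks, rather than in the number of
  customers times the longest block.\<close>

lemma runs_While:
  assumes body: "\<And>k s. l \<le> k \<Longrightarrow> k < h \<Longrightarrow> Inv k s \<Longrightarrow> bval b s \<and> runs p s (T k) (Inv (Suc k))"
    and exit: "\<And>s. Inv h s \<Longrightarrow> \<not> bval b s" and "l \<le> h" and "Inv l s"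
  shows "runs (While b p) s ((\<Sum>k=l..<h. T k + 1 + btime b) + 1 + btime b) (Inv h)"
  using \<open>l \<le> h\<close> \<open>Inv l s\<close>
proof (induction arbitrary: s rule: inc_induct)
  case base
  then have "exec (While b p) s (1 + btime b) s" by (intro exec.WhileFalse exit)
  with base show ?case unfolding runs_def by force
next
  case (step k)
  from body[OF step.hyps step.prems] obtain t s' where
    "bval b s" "exec p s t s'" and t: "t \<le> T k" and "Inv (Suc k) s'"
    unfolding runs_def by blast
  moreover from step.IH[OF this(4)] obtain t' s'' where "exec (While b p) s' t' s''"
    and t': "t' \<le> (\<Sum>k=Suc k..<h. T k + 1 + btime b) + 1 + btime b" and "Inv h s''"
    unfolding runs_def by blast
  ultimately have "exec (While b p) s (1 + btime b + t + t') s'' \<and> Inv h s''"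
    by (blast intro: exec.WhileTrue)
  moreover have "1 + btime b + t + t' \<le> (\<Sum>k=k..<h. T k + 1 + btime b) + 1 + btime b"
    using t t' step.hyps by (simp add: sum.atLeast_Suc_lessThan)
  ultimately show ?case unfolding runs_def by blast
qed

text \<open>Loop-free programs always halt, so their result and a time bound are recursive functions
  that the simplifier can evaluate, without derivations in \<open>exec\<close>.\<close>

primrec straight :: "com \<Rightarrow> bool" where
  "straight Skip = True"
| "straight (NStore a i e) = True"
| "straight (RStore a i e) = True"
| "straight (Seq p q) = (straight p \<and> straight q)"
| "straight (Cond b p q) = (straight p \<and> straight q)"
| "straight (While b p) = False"

text \<open>The clauses for loops are junk: both functions are only used for straight-line programs.\<close>

primrec effect :: "com \<Rightarrow> memory \<Rightarrow> memory" where
  "effect Skip s = s"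
| "effect (NStore a i e) s = s\<lparr>nmem := (nmem s)(a := (nmem s a)(nval i s := nval e s))\<rparr>"
| "effect (RStore a i e) s = s\<lparr>rmem := (rmem s)(a := (rmem s a)(nval i s := rval e s))\<rparr>"
| "effect (Seq p q) s = effect q (effect p s)"
| "effect (Cond b p q) s = (if bval b s then effect p s else effect q s)"
| "effect (While b p) s = s"

primrec duration :: "com \<Rightarrow> nat" where
  "duration Skip = 1"
| "duration (NStore a i e) = 1 + ntime i + ntime e"
| "duration (RStore a i e) = 1 + ntime i + rtime e"
| "duration (Seq p q) = duration p + duration q"
| "duration (Cond b p q) = 1 + btime b + max (duration p) (duration q)"
| "duration (While b p) = 0"

lemma exec_straight: "straight p \<Longrightarrow> \<exists>t\<le>duration p. exec p s t (effect p s)"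
proof (induction p arbitrary: s)
  case (Seq p q)
  then obtain t t' where "t \<le> duration p" "exec p s t (effect p s)"
    "t' \<le> duration q" "exec q (effect p s) t' (effect q (effect p s))"
    by fastforce
  then show ?case by (intro exI[of _ "t + t'"]) (auto intro: exec.Seq)
next
  case (Cond b p q)
  show ?case
  proof (cases "bval b s")
    case True
    with Cond obtain t where "t \<le> duration p" "exec p s t (effect p s)" by fastforce
    with True show ?thesis
      by (intro exI[of _ "1 + btime b + t"]) (auto intro: exec.CondTrue[simplified])
  next
    case False
    with Cond obtain t where "t \<le> duration q" "exec q s t (effect q s)" by fastforce
    with False show ?thesis
      by (intro exI[of _ "1 + btime b + t"]) (auto intro: exec.CondFalse[simplified])
  qed
qed (auto intro: exec.intros[simplified] exec.intros)

lemma runs_straight: "straight p \<Longrightarrow> duration p \<le> T \<Longrightarrow> Q (effect p s) \<Longrightarrow> runs p s T Q"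
  unfolding runs_def using exec_straight[of p s] by (meson order_trans)

lemma runs_Seq_straight:
  "straight p \<Longrightarrow> runs q (effect p s) T Q \<Longrightarrow> runs (Seq p q) s (duration p + T) Q"
  by (rule runs_Seq) (rule runs_straight, simp_all)

lemma runs_While_straight:
  assumes "straight p"
    and step: "\<And>k s. l \<le> k \<Longrightarrow> k < h \<Longrightarrow> Inv k s \<Longrightarrow> Inv (Suc k) (effect p s)"
    and guard: "\<And>k s. Inv k s \<Longrightarrow> bval b s \<longleftrightarrow> k < h" and "l \<le> h" and "Inv l s"
  shows "runs (While b p) s ((h - l) * (duration p + 1 + btime b) + 1 + btime b) (Inv h)"
proof -
  have "runs (While b p) s ((\<Sum>k=l..<h. duration p + 1 + btime b) + 1 + btime b) (Inv h)"
  proof (rule runs_While)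
    fix k s assume "l \<le> k" "k < h" "Inv k s"
    then show "bval b s \<and> runs p s (duration p) (Inv (Suc k))"
      using guard step by (auto intro: runs_straight \<open>straight p\<close>)
  qed (use guard assms(4,5) in auto)
  then show ?thesis by simp
qed

text \<open>Scalar variables are arrays of which only position \<open>0\<close> is used.\<close>

abbreviation nvar :: "name \<Rightarrow> nexp" where "nvar a \<equiv> NLoad a (NConst 0)"

abbreviation rvar :: "name \<Rightarrow> rexp" where "rvar a \<equiv> RLoad a (NConst 0)"

abbreviation nassign :: "name \<Rightarrow> nexp \<Rightarrow> com" where "nassign a e \<equiv> NStore a (NConst 0) e"

abbreviation rassign :: "name \<Rightarrow> rexp \<Rightarrow> com" where "rassign a e \<equiv> RStore a (NConst 0) e"

abbreviation incr :: "name \<Rightarrow> com" where "incr a \<equiv> nassign a (NAdd (nvar a) (NConst 1))"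

section \<open>The level program\<close>

abbreviation dist_k :: rexp where "dist_k \<equiv> RLoad ''dist'' (nvar ''k'')"

abbreviation adj_k :: nexp where "adj_k \<equiv> NLoad ''adj'' (nvar ''k'')"

abbreviation open_k :: rexp where "open_k \<equiv> RLoad ''open'' adj_k"

abbreviation y_k :: rexp where "y_k \<equiv> RLoad ''y'' adj_k"

abbreviation price_k :: rexp where
  "price_k \<equiv> RAdd dist_k (RMul open_k (RSub (RConst 1) y_k))"

abbreviation in_block :: bexp where
  "in_block \<equiv> NLess (nvar ''k'') (NLoad ''off'' (NAdd (nvar ''i'') (NConst 1)))"

text \<open>Besides the running minimum of the prices, the pass sets \<open>sat\<close> if some
  level in the block has reached \<open>1\<close>; this decides the second disjunct of the test in
  \<open>next_levels\<close>.\<close>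

definition bid_body :: com where
  "bid_body =
     Seq (Cond (RLess price_k (rvar ''beta'')) (rassign ''beta'' price_k) Skip)
     (Seq (Cond (RLess y_k (RConst 1)) Skip (nassign ''sat'' (NConst 1)))
     (incr ''k''))"

text \<open>The nested conditional is the case distinction of \<open>level\<close>. The guard of the
  write to \<open>y\<close> combines the maximum in \<open>next_levels\<close>, as the comparison of
  \<open>y\<close> with \<open>lev\<close>, and its disjunction, expressed by negation and
  conjunction.\<close>

definition raise_body :: com where
  "raise_body =
     Seq (Cond (RLess (RConst 0) (RAdd dist_k open_k))
       (Cond (RLess (rvar ''beta'') (RMul dist_k y_k))
         (rassign ''lev'' (RDiv (rvar ''beta'') dist_k))
         (rassign ''lev'' (RDiv (RAdd (rvar ''beta'') (RMul open_k y_k)) (RAdd dist_k open_k))))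
       (rassign ''lev'' (RConst 1)))
     (Seq (Cond (RLess (rvar ''lev'') (RConst 1))
       (RStore ''x'' (nvar ''k'') (RConst 0)) (RStore ''x'' (nvar ''k'') (RConst 1)))
     (Seq (Cond (BAnd (RLess y_k (rvar ''lev''))
         (BNot (BAnd (BNot (RLess (RConst 0) (RAdd dist_k open_k))) (NLess (NConst 0) (nvar ''sat'')))))
       (RStore ''y'' adj_k (rvar ''lev'')) Skip)
     (incr ''k'')))"

text \<open>The machine has no infinity to start a minimum with, so \<open>beta\<close> starts as
  the price at the first position of the block, which exists because \<open>N i\<close> is nonempty.
  Hence the \<open>insert (off i)\<close> in \<open>bid_inv\<close>.\<close>

definition start_block :: com where
  "start_block = Seq (nassign ''k'' (NLoad ''off'' (nvar ''i'')))
     (Seq (nassign ''sat'' (NConst 0)) (rassign ''beta'' price_k))"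

text \<open>Two passes over the block: the bid is a minimum over all of it and \<open>sat\<close>
  refers to the old levels, so both must be final before any level is overwritten.\<close>

definition customer_body :: com where
  "customer_body = Seq start_block (Seq (While in_block bid_body)
     (Seq (nassign ''k'' (NLoad ''off'' (nvar ''i''))) (Seq (While in_block raise_body) (incr ''i''))))"

definition levels_program :: com where
  "levels_program = Seq (nassign ''i'' (NConst 0)) (While (NLess (nvar ''i'') (nvar ''m'')) customer_body)"

section \<open>Correctness and running time of the level program\<close>

definition frame :: "memory \<Rightarrow> memory \<Rightarrow> bool" where
  "frame s0 s \<longleftrightarrow> (\<forall>a. a \<notin> {''i'', ''k'', ''sat''} \<longrightarrow> nmem s a = nmem s0 a) \<and>
     (\<forall>a. a \<notin> {''y'', ''beta'', ''lev'', ''x''} \<longrightarrow> rmem s a = rmem s0 a)"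

lemma frame_mem:
  assumes "frame s0 s"
  shows "nmem s ''off'' = nmem s0 ''off''" "nmem s ''adj'' = nmem s0 ''adj''"
    "nmem s ''m'' = nmem s0 ''m''" "nmem s ''n'' = nmem s0 ''n''"
    "rmem s ''dist'' = rmem s0 ''dist''" "rmem s ''open'' = rmem s0 ''open''"
  using assms by (auto simp: frame_def)

context location
begin

definition stored :: "memory \<Rightarrow> bool" where
  "stored s \<longleftrightarrow> nmem s ''m'' 0 = m \<and> nmem s ''off'' 0 = 0 \<and>
     (\<forall>i<m. nmem s ''off'' (i + 1) = nmem s ''off'' i + card (N i) \<and>
        bij_betw (nmem s ''adj'') {nmem s ''off'' i..<nmem s ''off'' (i + 1)} (N i) \<and>
        (\<forall>k\<in>{nmem s ''off'' i..<nmem s ''off'' (i + 1)}. rmem s ''dist'' k = d i (nmem s ''adj'' k)) \<and>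
        (\<forall>j\<in>N i. rmem s ''open'' j = f j))"

definition flag :: "nat \<Rightarrow> nat \<Rightarrow> real" where
  "flag i j = (if raise_to (levels i) i j < 1 then 0 else 1)"

text \<open>\<open>A\<close> collects the facilities whose cells of \<open>y\<close> are tracked. It
  is a parameter because the programs differ in which cells they initialise: those occurring in
  adjacency lists for facility location, all below \<open>n\<close> for set cover.\<close>

context
  fixes s0 :: memory and A :: "nat set"
  assumes stored: "stored s0" and A: "\<And>i. i < m \<Longrightarrow> N i \<subseteq> A"
begin

abbreviation "off \<equiv> nmem s0 ''off''"
abbreviation "adj \<equiv> nmem s0 ''adj''"

lemma off_Suc: "i < m \<Longrightarrow> off (Suc i) = off i + card (N i)"
  using stored by (simp add: stored_def)

lemma off_mono: "i \<le> i' \<Longrightarrow> i' \<le> m \<Longrightarrow> off i \<le> off i'"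
  by (induction i' rule: dec_induct) (auto simp: off_Suc)

lemma off_less: "i < m \<Longrightarrow> off i < off (Suc i)"
  using N_nonempty finite_N by (simp add: off_Suc card_gt_0_iff)

lemma adj_bij: "i < m \<Longrightarrow> bij_betw adj {off i..<off (Suc i)} (N i)"
  using stored unfolding stored_def Suc_eq_plus1 by blast

lemma adj_mem: "i < m \<Longrightarrow> off i \<le> k \<Longrightarrow> k < off (Suc i) \<Longrightarrow> adj k \<in> N i"
  using adj_bij[of i] by (auto simp: bij_betw_def)

lemma block_unique:
  assumes "i < m" "i' < m" "off i \<le> k" "k < off (Suc i)" "off i' \<le> k" "k < off (Suc i')"
  shows "i = i'"
proof (rule ccontr)
  assume "i \<noteq> i'"
  then have "Suc i \<le> i' \<or> Suc i' \<le> i" by auto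
  then show False using off_mono[of "Suc i" i'] off_mono[of "Suc i'" i] assms by auto
qed

definition outputs_upto :: "nat \<Rightarrow> memory \<Rightarrow> bool" where
  "outputs_upto h s \<longleftrightarrow> (\<forall>i<m. \<forall>k\<in>{off i..<off (Suc i)}. k < h \<longrightarrow> rmem s ''x'' k = flag i (adj k))"

definition customer_inv :: "nat \<Rightarrow> memory \<Rightarrow> bool" where
  "customer_inv i s \<longleftrightarrow> frame s0 s \<and> nmem s ''i'' 0 = i \<and>
     (\<forall>j\<in>A. rmem s ''y'' j = levels i j) \<and> outputs_upto (off i) s"

definition bid_inv :: "nat \<Rightarrow> nat \<Rightarrow> memory \<Rightarrow> bool" where
  "bid_inv i k s \<longleftrightarrow> customer_inv i s \<and> nmem s ''k'' 0 = k \<and>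
     rmem s ''beta'' 0 = Min (price (levels i) i ` adj ` insert (off i) {off i..<k}) \<and>
     nmem s ''sat'' 0 = (if \<forall>j\<in>adj ` {off i..<k}. levels i j < 1 then 0 else 1)"

definition raise_inv :: "nat \<Rightarrow> nat \<Rightarrow> memory \<Rightarrow> bool" where
  "raise_inv i k s \<longleftrightarrow> frame s0 s \<and> nmem s ''i'' 0 = i \<and> nmem s ''k'' 0 = k \<and>
     rmem s ''beta'' 0 = bid (levels i) i \<and>
     nmem s ''sat'' 0 = (if \<forall>j\<in>N i. levels i j < 1 then 0 else 1) \<and> outputs_upto k s \<and>
     (\<forall>j\<in>A. rmem s ''y'' j = (if j \<in> adj ` {off i..<k} then levels (Suc i) j else levels i j))"

lemma stored_at:
  assumes "frame s0 s" "i < m" "off i \<le> k" "k < off (Suc i)"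
  shows "rmem s ''dist'' k = d i (adj k)" "rmem s ''open'' (adj k) = f (adj k)"
  using stored assms adj_mem[OF assms(2-4)] by (auto simp: stored_def frame_mem)

lemma bid_body_step:
  assumes i: "i < m" and k: "off i \<le> k" "k < off (Suc i)" and inv: "bid_inv i k s"
  shows "bid_inv i (Suc k) (effect bid_body s)"
proof -
  have fr: "frame s0 s" using inv by (simp add: bid_inv_def customer_inv_def)
  have "adj k \<in> A" using adj_mem[OF i k] A[OF i] by blast
  then have y: "rmem s ''y'' (adj k) = levels i (adj k)" and kk: "nmem s ''k'' 0 = k"
    using inv by (auto simp: bid_inv_def customer_inv_def)
  have eq: "{off i..<Suc k} = insert k {off i..<k}" using k by auto
  let ?B = "price (levels i) i ` adj ` insert (off i) {off i..<k}"
  have "price (levels i) i ` adj ` insert (off i) {off i..<Suc k} = insert (price (levels i) i (adj k)) ?B"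
    unfolding eq by auto
  moreover have "Min (insert (price (levels i) i (adj k)) ?B) = min (price (levels i) i (adj k)) (Min ?B)"
    by (rule Min_insert) auto
  ultimately have "Min (price (levels i) i ` adj ` insert (off i) {off i..<Suc k}) =
      min (price (levels i) i (adj k)) (Min ?B)" by simp
  moreover have s: "nmem (effect bid_body s) = (nmem s)(''k'' := (nmem s ''k'')(0 := Suc k),
      ''sat'' := (nmem s ''sat'')(0 := if levels i (adj k) < 1 then nmem s ''sat'' 0 else 1))"
    "rmem (effect bid_body s) = (rmem s)(''beta'' :=
      (rmem s ''beta'')(0 := min (price (levels i) i (adj k)) (rmem s ''beta'' 0)))"
    using kk y stored_at[OF fr i k] frame_mem[OF fr]
    by (auto simp: bid_body_def price_def fun_eq_iff)
  moreover have "customer_inv i (effect bid_body s)"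
    using inv unfolding bid_inv_def customer_inv_def frame_def outputs_upto_def s by simp
  ultimately show ?thesis
    using inv unfolding bid_inv_def s eq by simp
qed

lemma raise_body_step:
  assumes i: "i < m" and k: "off i \<le> k" "k < off (Suc i)" and inv: "raise_inv i k s"
  shows "raise_inv i (Suc k) (effect raise_body s)"
proof -
  have fr: "frame s0 s" using inv by (simp add: raise_inv_def)
  have j: "adj k \<in> N i" by (rule adj_mem[OF i k])
  \<comment> \<open>Levels are updated in place, so \<open>y\<close> mixes old and new values within
    a block. As a block has no repetitions, the cell read at position \<open>k\<close> is still an
    old one.\<close>
  have new: "adj k \<notin> adj ` {off i..<k}"
    using bij_betw_imp_inj_on[OF adj_bij[OF i]] k by (auto dest!: inj_onD)
  have y: "rmem s ''y'' (adj k) = levels i (adj k)" and kk: "nmem s ''k'' 0 = k"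
    using inv A[OF i] j new by (auto simp: raise_inv_def)
  have eq: "{off i..<Suc k} = insert k {off i..<k}" using k by auto
  \<comment> \<open>Position \<open>k\<close> lies in no other block, so the value written to
    \<open>x\<close> there can only be the one required for customer \<open>i\<close>.\<close>
  have un: "i' = i" if "i' < m" "off i' \<le> k" "k < off (Suc i')" for i'
    using block_unique[OF that(1) i that(2,3) k] .
  let ?s = "effect raise_body s" and ?L = "raise_to (levels i) i (adj k)"
  have s: "nmem ?s = (nmem s)(''k'' := (nmem s ''k'')(0 := Suc k))"
    "rmem ?s ''x'' = (rmem s ''x'')(k := flag i (adj k))"
    "rmem ?s ''y'' = (rmem s ''y'')(adj k := levels (Suc i) (adj k))"
    "rmem ?s ''beta'' = rmem s ''beta''"
    "\<And>a. a \<notin> {''y'', ''beta'', ''lev'', ''x''} \<Longrightarrow> rmem ?s a = rmem s a"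
    using inv kk y j stored_at[OF fr i k] frame_mem[OF fr]
    unfolding raise_inv_def
    by (auto simp: raise_body_def flag_def next_levels_def raise_to_def level_def fun_eq_iff)
  have "frame s0 ?s" using fr s(1,5) by (auto simp: frame_def)
  moreover have "outputs_upto (Suc k) ?s"
    using inv un by (auto simp: raise_inv_def outputs_upto_def s less_Suc_eq)
  ultimately show ?thesis
    using inv new by (auto simp: raise_inv_def s(1-4) eq simp del: levels.simps)
qed

lemma raise_inv_start:
  assumes i: "i < m" and inv: "bid_inv i (off (Suc i)) s"
  shows "raise_inv i (off i) (effect (nassign ''k'' (NLoad ''off'' (nvar ''i''))) s)"
proof -
  have fr: "frame s0 s" using inv by (simp add: bid_inv_def customer_inv_def)
  have N: "adj ` {off i..<off (Suc i)} = N i"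
    using adj_bij[OF i] by (simp add: bij_betw_def)
  have "insert (off i) {off i..<off (Suc i)} = {off i..<off (Suc i)}"
    using off_less[OF i] by auto
  then have "Min (price (levels i) i ` adj ` insert (off i) {off i..<off (Suc i)}) = bid (levels i) i"
    by (simp only: N bid_def)
  then show ?thesis
    using inv frame_mem[OF fr] N
    by (simp add: bid_inv_def customer_inv_def raise_inv_def frame_def outputs_upto_def)
qed

lemma raise_inv_end:
  assumes i: "i < m" and inv: "raise_inv i (off (Suc i)) s"
  shows "customer_inv (Suc i) (effect (incr ''i'') s)"
proof -
  have N: "adj ` {off i..<off (Suc i)} = N i"
    using adj_bij[OF i] by (simp add: bij_betw_def)
  have "levels (Suc i) j = levels i j" if "j \<notin> N i" for j
    using that by (simp add: next_levels_def)
  then show ?thesis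
    using inv unfolding raise_inv_def N
    by (simp add: customer_inv_def frame_def outputs_upto_def del: levels.simps)
qed

lemma bid_inv_start:
  assumes i: "i < m" and inv: "customer_inv i s"
  shows "bid_inv i (off i) (effect start_block s)"
proof -
  have fr: "frame s0 s" using inv by (simp add: customer_inv_def)
  have "adj (off i) \<in> A" using adj_mem[OF i, of "off i"] off_less[OF i] A[OF i] by auto
  then show ?thesis
    using inv stored_at[OF fr i order_refl off_less[OF i]] frame_mem[OF fr]
    by (simp add: bid_inv_def customer_inv_def start_block_def frame_def outputs_upto_def price_def)
qed

text \<open>The constants are generous roundings of the durations of the two passes, which the final
  simplification computes; what matters is that they do not depend on the instance.\<close>

lemma customer_body_runs:
  assumes i: "i < m" and inv: "customer_inv i s"
  shows "runs customer_body s (200 * card (N i) + 100) (customer_inv (Suc i))"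
proof -
  have b: "bval in_block s \<longleftrightarrow> k < off (Suc i)"
    if "frame s0 s" "nmem s ''i'' 0 = i" "nmem s ''k'' 0 = k" for s k
    using that by (simp add: frame_mem)
  note le = less_imp_le[OF off_less[OF i]]
  have bid: "runs (While in_block bid_body) s ((off (Suc i) - off i) * (duration bid_body + 1 + btime in_block)
      + 1 + btime in_block) (bid_inv i (off (Suc i)))" if "bid_inv i (off i) s" for s
  proof (rule runs_While_straight)
    show "bval in_block s \<longleftrightarrow> k < off (Suc i)" if "bid_inv i k s" for k s
      using b[of s k] that by (simp add: bid_inv_def customer_inv_def)
    show "straight bid_body" by (simp add: bid_body_def)
  qed (use bid_body_step[OF i] le that in auto)
  have raise: "runs (While in_block raise_body) s ((off (Suc i) - off i) * (duration raise_body + 1 + btime in_block)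
      + 1 + btime in_block) (raise_inv i (off (Suc i)))" if "raise_inv i (off i) s" for s
  proof (rule runs_While_straight)
    show "bval in_block s \<longleftrightarrow> k < off (Suc i)" if "raise_inv i k s" for k s
      using b[of s k] that by (simp add: raise_inv_def)
    show "straight raise_body" by (simp add: raise_body_def)
  qed (use raise_body_step[OF i] le that in auto)
  have "runs customer_body s (duration start_block +
      (((off (Suc i) - off i) * (duration bid_body + 1 + btime in_block) + 1 + btime in_block) +
      (duration (nassign ''k'' (NLoad ''off'' (nvar ''i''))) +
      (((off (Suc i) - off i) * (duration raise_body + 1 + btime in_block) + 1 + btime in_block) +
       duration (incr ''i''))))) (customer_inv (Suc i))"
    unfolding customer_body_def
    apply (rule runs_Seq_straight)
     apply (simp add: start_block_def)
    apply (rule runs_Seq)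
    apply (rule runs_mono[OF bid[OF bid_inv_start[OF i inv]] order_refl])
    apply (rule runs_Seq_straight)
     apply simp
    apply (rule runs_Seq)
    apply (rule runs_mono[OF raise[OF raise_inv_start[OF i]] order_refl])
     apply assumption
    apply (rule runs_straight)
      apply simp
     apply (rule order_refl)
    apply (rule raise_inv_end[OF i])
    apply assumption
    done
  then show ?thesis
    by (rule runs_mono)
      (simp_all add: off_Suc[OF i] start_block_def bid_body_def raise_body_def)
qed

lemma levels_program_runs:
  assumes y: "\<And>j. j \<in> A \<Longrightarrow> rmem s0 ''y'' j = 0"
  shows "runs levels_program s0 (200 * (\<Sum>i<m. card (N i)) + 120 * m + 20)
    (\<lambda>s. frame s0 s \<and> (\<forall>j\<in>A. rmem s ''y'' j = levels m j) \<and>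
       (\<forall>i<m. \<forall>k\<in>{off i..<off (Suc i)}. rmem s ''x'' k = flag i (adj k)))"
proof -
  let ?b = "NLess (nvar ''i'') (nvar ''m'')"
  have b: "bval ?b s \<longleftrightarrow> i < m" if "customer_inv i s" for i s
    using that stored by (auto simp: customer_inv_def frame_mem stored_def)
  have "customer_inv 0 (effect (nassign ''i'' (NConst 0)) s0)"
    using y stored by (auto simp: customer_inv_def frame_def outputs_upto_def stored_def)
  then have "runs (While ?b customer_body) (effect (nassign ''i'' (NConst 0)) s0)
      ((\<Sum>i=0..<m. 200 * card (N i) + 100 + 1 + btime ?b) + 1 + btime ?b) (customer_inv m)"
    using b customer_body_runs by (intro runs_While) auto
  then have "runs levels_program s0 (duration (nassign ''i'' (NConst 0)) +
      ((\<Sum>i=0..<m. 200 * card (N i) + 100 + 1 + btime ?b) + 1 + btime ?b)) (customer_inv m)"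
    unfolding levels_program_def by (intro runs_Seq_straight) simp_all
  then show ?thesis
  proof (rule runs_mono)
    fix s assume inv: "customer_inv m s"
    have "k < off m" if "i < m" "k < off (Suc i)" for i k
      using off_mono[of "Suc i" m] that by simp
    then show "frame s0 s \<and> (\<forall>j\<in>A. rmem s ''y'' j = levels m j) \<and>
       (\<forall>i<m. \<forall>k\<in>{off i..<off (Suc i)}. rmem s ''x'' k = flag i (adj k))"
      using inv by (auto simp: customer_inv_def outputs_upto_def)
  qed (simp add: sum.distrib sum_distrib_left atLeast0LessThan)
qed

lemma off_m: "off m = (\<Sum>i<m. card (N i))"
proof -
  have "i \<le> m \<Longrightarrow> off i = (\<Sum>i<i. card (N i))" for i
    using stored by (induction i) (auto simp: off_Suc stored_def)
  then show ?thesis by simp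
qed

lemma adj_surj: "i < m \<Longrightarrow> j \<in> N i \<Longrightarrow> \<exists>k<off m. adj k = j"
  using bij_betw_imp_surj_on[OF adj_bij, of i] off_mono[of "Suc i" m] by force

end

end

lemma linear_time_greedyI:
  assumes "\<And>I s. valid I \<Longrightarrow> inp I s \<Longrightarrow>
    \<exists>z. runs p s (K * (sz I + 1)) (\<lambda>s'. outp I s s' z) \<and> greedy_result (M I) z \<and> Delta_approximate (M I) z"
  shows "linear_time_greedy valid M sz inp outp"
  using assms unfolding linear_time_greedy_def runs_def by meson

section \<open>Facility location\<close>

text \<open>Levels are cleared along the adjacency lists instead of over all \<open>n\<close>
  facilities: \<open>fl_size\<close> does not count facilities that serve no customer, so a loop up
  to \<open>n\<close> could exceed linear time. Clearing a cell repeatedly does no harm.\<close>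

definition facility_program :: com where
  "facility_program = Seq (nassign ''k'' (NConst 0))
     (Seq (While (NLess (nvar ''k'') (NLoad ''off'' (nvar ''m''))) (Seq (RStore ''y'' adj_k (RConst 0)) (incr ''k'')))
     levels_program)"

lemma (in location) facility_program_runs:
  assumes st: "stored s0"
  shows "runs facility_program s0 (300 * (\<Sum>i<m. card (N i)) + 120 * m + 100)
    (\<lambda>s. \<forall>i<m. \<forall>k\<in>{nmem s0 ''off'' i..<nmem s0 ''off'' (Suc i)}.
       rmem s ''x'' k = flag i (nmem s0 ''adj'' k))"
proof -
  let ?b = "NLess (nvar ''k'') (NLoad ''off'' (nvar ''m''))"
  let ?p = "Seq (RStore ''y'' adj_k (RConst 0)) (incr ''k'')"
  define A where "A = (\<Union>i<m. N i)"
  define inv where "inv k s \<longleftrightarrow> frame s0 s \<and> nmem s ''k'' 0 = k \<and>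
    (\<forall>k'<k. rmem s ''y'' (nmem s0 ''adj'' k') = 0)" for k and s :: memory
  have A: "\<And>i. i < m \<Longrightarrow> N i \<subseteq> A" by (auto simp: A_def)
  note off_m = off_m[OF st A] and surj = adj_surj[OF st A]
  have m: "nmem s0 ''m'' 0 = m" using st by (simp add: stored_def)
  let ?s1 = "effect (nassign ''k'' (NConst 0)) s0"
  have "runs (While ?b ?p) ?s1 ((nmem s0 ''off'' m - 0) * (duration ?p + 1 + btime ?b) + 1 + btime ?b)
      (inv (nmem s0 ''off'' m))"
  proof (rule runs_While_straight)
    show "inv (Suc k) (effect ?p s)" if "inv k s" for k s
      using that unfolding inv_def by (auto simp: frame_mem[of s0 s] frame_def less_Suc_eq)
    show "bval ?b s \<longleftrightarrow> k < nmem s0 ''off'' m" if "inv k s" for k s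
      using that by (auto simp: inv_def frame_mem[of s0 s] m)
    show "inv 0 ?s1" by (simp add: inv_def frame_def)
  qed simp_all
  moreover have "runs levels_program s (200 * (\<Sum>i<m. card (N i)) + 120 * m + 20)
    (\<lambda>s. \<forall>i<m. \<forall>k\<in>{nmem s0 ''off'' i..<nmem s0 ''off'' (Suc i)}.
       rmem s ''x'' k = flag i (nmem s0 ''adj'' k))" if inv: "inv (nmem s0 ''off'' m) s" for s
  proof -
    have fr: "frame s0 s" using inv by (simp add: inv_def)
    have st': "stored s" using st unfolding stored_def frame_mem[OF fr] .
    have "rmem s ''y'' j = 0" if "j \<in> A" for j
      using that surj inv by (force simp: A_def inv_def)
    from levels_program_runs[OF st' A this] show ?thesis
      unfolding frame_mem[OF fr] by (rule runs_mono) auto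
  qed
  ultimately have "runs facility_program s0 (duration (nassign ''k'' (NConst 0)) +
      (((nmem s0 ''off'' m - 0) * (duration ?p + 1 + btime ?b) + 1 + btime ?b) +
       (200 * (\<Sum>i<m. card (N i)) + 120 * m + 20)))
    (\<lambda>s. \<forall>i<m. \<forall>k\<in>{nmem s0 ''off'' i..<nmem s0 ''off'' (Suc i)}.
       rmem s ''x'' k = flag i (nmem s0 ''adj'' k))"
    unfolding facility_program_def
    by (intro runs_Seq_straight runs_Seq) (auto elim: runs_mono)
  then show ?thesis
    by (rule runs_mono) (simp_all add: off_m)
qed

lemma linear_time_greedy_facility_location:
  "linear_time_greedy facility_location fl_covering fl_size fl_input fl_output"
proof (rule linear_time_greedyI[where p = facility_program and K = 500])
  fix I s
  assume I: "facility_location I" and inp: "fl_input I s"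
  interpret location "customers I" "serving I" "opening_cost I" "service_cost I"
    by (rule location_facility[OF I])
  define z where "z = (\<lambda>(i, j). if i < customers I \<and> j \<in> serving I i \<and>
    1 \<le> raise_to (levels i) i j then 1 else 0 :: real)"
  have st: "stored s"
    using inp serving_props(3)[OF I] unfolding stored_def fl_input_def by blast
  have bij: "bij_betw (nmem s ''adj'') {nmem s ''off'' i..<nmem s ''off'' (Suc i)} (serving I i)"
    if "i < customers I" for i
    using inp that unfolding fl_input_def Suc_eq_plus1 by blast
  \<comment> \<open>Each customer has at least one facility, so the constant overhead per customer
    is absorbed by \<open>fl_size I\<close>.\<close>
  have "customers I \<le> fl_size I"
  proof -
    have "(\<Sum>i<customers I. 1) \<le> (\<Sum>i<customers I. card (serving I i))"
      using finite_N N_nonempty by (intro sum_mono) (auto simp: Suc_le_eq card_gt_0_iff)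
    then show ?thesis by (simp add: fl_size_def)
  qed
  then have "runs facility_program s (500 * (fl_size I + 1)) (\<lambda>s'. fl_output I s s' z)"
    using bij by (intro runs_mono[OF facility_program_runs[OF st]])
      (auto simp: fl_size_def fl_output_def z_def flag_def bij_betw_def)
  then show "\<exists>z. runs facility_program s (500 * (fl_size I + 1)) (\<lambda>s'. fl_output I s s' z) \<and>
      greedy_result (fl_covering I) z \<and> Delta_approximate (fl_covering I) z"
    using fl_levels_result[OF I] unfolding z_def by blast
qed

section \<open>Set cover and vertex cover\<close>

text \<open>Presents set cover to \<open>levels_program\<close> as facility location: costs become
  opening costs and service costs are \<open>0\<close>. A loop over all \<open>n\<close> sets is
  affordable here, because \<open>sc_size\<close> counts them.\<close>

definition cover_init :: com where
  "cover_init = Seq (nassign ''k'' (NConst 0))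
     (Seq (While (NLess (nvar ''k'') (nvar ''n''))
       (Seq (RStore ''open'' (nvar ''k'') (RLoad ''cost'' (nvar ''k'')))
       (Seq (RStore ''y'' (nvar ''k'') (RConst 0)) (incr ''k''))))
     (Seq (nassign ''k'' (NConst 0))
     (While (NLess (nvar ''k'') (NLoad ''off'' (nvar ''m'')))
       (Seq (RStore ''dist'' (nvar ''k'') (RConst 0)) (incr ''k'')))))"

text \<open>\<open>levels_program\<close> fills \<open>x\<close> by adjacency positions. For set
  cover the solution is indexed by sets and given by the rounded levels, so \<open>x\<close> is
  overwritten.\<close>

definition cover_output :: com where
  "cover_output = Seq (nassign ''k'' (NConst 0)) (While (NLess (nvar ''k'') (nvar ''n''))
     (Seq (Cond (RLess (RLoad ''y'' (nvar ''k'')) (RConst 1))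
       (RStore ''x'' (nvar ''k'') (RConst 0)) (RStore ''x'' (nvar ''k'') (RConst 1))) (incr ''k'')))"

definition cover_program :: com where
  "cover_program = Seq cover_init (Seq levels_program cover_output)"

lemma cover_init_runs:
  "runs cover_init s0 (50 * (nmem s0 ''n'' 0 + nmem s0 ''off'' (nmem s0 ''m'' 0)) + 100)
    (\<lambda>s. (\<forall>a. a \<noteq> ''k'' \<longrightarrow> nmem s a = nmem s0 a) \<and>
      (\<forall>j<nmem s0 ''n'' 0. rmem s ''open'' j = rmem s0 ''cost'' j \<and> rmem s ''y'' j = 0) \<and>
      (\<forall>k<nmem s0 ''off'' (nmem s0 ''m'' 0). rmem s ''dist'' k = 0))"
proof -
  let ?n = "nmem s0 ''n'' 0" and ?h = "nmem s0 ''off'' (nmem s0 ''m'' 0)"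
  define inv where "inv k s \<longleftrightarrow> (\<forall>a. a \<noteq> ''k'' \<longrightarrow> nmem s a = nmem s0 a) \<and> nmem s ''k'' 0 = k \<and>
    rmem s ''cost'' = rmem s0 ''cost'' \<and>
    (\<forall>j<k. rmem s ''open'' j = rmem s0 ''cost'' j \<and> rmem s ''y'' j = 0)" for k and s :: memory
  define inv' where "inv' k s \<longleftrightarrow> (\<forall>a. a \<noteq> ''k'' \<longrightarrow> nmem s a = nmem s0 a) \<and> nmem s ''k'' 0 = k \<and>
    (\<forall>j<?n. rmem s ''open'' j = rmem s0 ''cost'' j \<and> rmem s ''y'' j = 0) \<and>
    (\<forall>k'<k. rmem s ''dist'' k' = 0)" for k and s :: memory
  let ?b = "NLess (nvar ''k'') (nvar ''n'')" and ?b' = "NLess (nvar ''k'') (NLoad ''off'' (nvar ''m''))"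
  let ?p = "Seq (RStore ''open'' (nvar ''k'') (RLoad ''cost'' (nvar ''k'')))
       (Seq (RStore ''y'' (nvar ''k'') (RConst 0)) (incr ''k''))"
    and ?p' = "Seq (RStore ''dist'' (nvar ''k'') (RConst 0)) (incr ''k'')"
  have loop: "runs (While ?b ?p) s ((?n - 0) * (duration ?p + 1 + btime ?b) + 1 + btime ?b) (inv ?n)"
    if "inv 0 s" for s
  proof (rule runs_While_straight[where Inv = inv, OF _ _ _ _ that])
    show "inv (Suc k) (effect ?p s)" if "inv k s" for k s
      using that by (auto simp: inv_def less_Suc_eq)
    show "bval ?b s \<longleftrightarrow> k < ?n" if "inv k s" for k s
      using that by (auto simp: inv_def)
  qed simp_all
  have loop': "runs (While ?b' ?p') s ((?h - 0) * (duration ?p' + 1 + btime ?b') + 1 + btime ?b') (inv' ?h)"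
    if "inv' 0 s" for s
  proof (rule runs_While_straight[where Inv = inv', OF _ _ _ _ that])
    show "inv' (Suc k) (effect ?p' s)" if "inv' k s" for k s
      using that by (auto simp: inv'_def less_Suc_eq)
    show "bval ?b' s \<longleftrightarrow> k < ?h" if "inv' k s" for k s
      using that by (auto simp: inv'_def)
  qed simp_all
  have init: "inv 0 (effect (nassign ''k'' (NConst 0)) s0)"
    by (simp add: inv_def)
  have switch: "inv' 0 (effect (nassign ''k'' (NConst 0)) s)" if "inv ?n s" for s
    using that by (simp add: inv_def inv'_def)
  have "runs cover_init s0 (duration (nassign ''k'' (NConst 0)) +
      (((?n - 0) * (duration ?p + 1 + btime ?b) + 1 + btime ?b) +
      (duration (nassign ''k'' (NConst 0)) +
      ((?h - 0) * (duration ?p' + 1 + btime ?b') + 1 + btime ?b')))) (inv' ?h)"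
    unfolding cover_init_def
    by (rule runs_Seq_straight, simp, rule runs_Seq, rule runs_mono[OF loop[OF init] order_refl],
        rule runs_Seq_straight, simp, rule loop'[OF switch])
  then show ?thesis
    by (rule runs_mono) (auto simp: inv'_def)
qed

lemma cover_output_runs:
  "runs cover_output s0 (50 * nmem s0 ''n'' 0 + 50)
    (\<lambda>s. \<forall>j<nmem s0 ''n'' 0. rmem s ''x'' j = (if rmem s0 ''y'' j < 1 then 0 else 1))"
proof -
  let ?n = "nmem s0 ''n'' 0"
  define inv where "inv k s \<longleftrightarrow> nmem s ''n'' = nmem s0 ''n'' \<and> nmem s ''k'' 0 = k \<and>
    rmem s ''y'' = rmem s0 ''y'' \<and>
    (\<forall>j<k. rmem s ''x'' j = (if rmem s0 ''y'' j < 1 then 0 else 1))" for k and s :: memory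
  let ?b = "NLess (nvar ''k'') (nvar ''n'')"
  let ?p = "Seq (Cond (RLess (RLoad ''y'' (nvar ''k'')) (RConst 1))
       (RStore ''x'' (nvar ''k'') (RConst 0)) (RStore ''x'' (nvar ''k'') (RConst 1))) (incr ''k'')"
  have "runs (While ?b ?p) (effect (nassign ''k'' (NConst 0)) s0)
      ((?n - 0) * (duration ?p + 1 + btime ?b) + 1 + btime ?b) (inv ?n)"
  proof (rule runs_While_straight)
    show "inv (Suc k) (effect ?p s)" if "inv k s" for k s
      using that by (auto simp: inv_def less_Suc_eq)
    show "bval ?b s \<longleftrightarrow> k < ?n" if "inv k s" for k s
      using that by (auto simp: inv_def)
    show "inv 0 (effect (nassign ''k'' (NConst 0)) s0)" by (simp add: inv_def)
  qed simp_all
  then have "runs cover_output s0 (duration (nassign ''k'' (NConst 0)) +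
      ((?n - 0) * (duration ?p + 1 + btime ?b) + 1 + btime ?b)) (inv ?n)"
    unfolding cover_output_def by (intro runs_Seq_straight) simp_all
  then show ?thesis
    by (rule runs_mono) (auto simp: inv_def)
qed

text \<open>The format shared by set cover inputs and converted edge lists. In contrast to
  \<open>stored\<close>, it says nothing of \<open>open\<close> and \<open>dist\<close>, which
  \<open>cover_init\<close> creates.\<close>

definition cover_stored :: "nat \<Rightarrow> (nat \<Rightarrow> nat set) \<Rightarrow> nat \<Rightarrow> (nat \<Rightarrow> real) \<Rightarrow> memory \<Rightarrow> bool" where
  "cover_stored m N n f s \<longleftrightarrow> nmem s ''m'' 0 = m \<and> nmem s ''n'' 0 = n \<and>
     (\<forall>j<n. rmem s ''cost'' j = f j) \<and> nmem s ''off'' 0 = 0 \<and>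
     (\<forall>i<m. nmem s ''off'' (i + 1) = nmem s ''off'' i + card (N i) \<and>
        bij_betw (nmem s ''adj'') {nmem s ''off'' i..<nmem s ''off'' (i + 1)} (N i))"

lemma cover_program_runs:
  assumes cst: "cover_stored m N n f s0" and f: "\<And>j. j < n \<Longrightarrow> 0 \<le> f j"
    and N: "\<And>i. i < m \<Longrightarrow> N i \<subseteq> {..<n}" "\<And>i. i < m \<Longrightarrow> N i \<noteq> {}"
  shows "runs cover_program s0 (250 * (n + m + (\<Sum>i<m. card (N i)) + 1))
    (\<lambda>s. \<forall>j<n. rmem s ''x'' j = cover_solution m N f j)"
proof -
  interpret location m N f "\<lambda>_ _. 0"
    using f N by unfold_locales (auto intro: finite_subset[OF _ finite_lessThan] simp: subset_iff)
  let ?z = "cover_solution m N f" and ?off = "nmem s0 ''off''"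
  have n: "nmem s0 ''n'' 0 = n" and m: "nmem s0 ''m'' 0 = m" using cst by (auto simp: cover_stored_def)
  have off: "?off i = (\<Sum>i<i. card (N i))" if "i \<le> m" for i
    using that
  proof (induction i)
    case (Suc i)
    then have "?off (i + 1) = ?off i + card (N i)" using cst unfolding cover_stored_def by simp
    then show ?case using Suc by simp
  qed (use cst in \<open>simp add: cover_stored_def\<close>)
  have le: "?off (i + 1) \<le> ?off m" if "i < m" for i
  proof -
    have "(\<Sum>i<i + 1. card (N i)) \<le> (\<Sum>i<m. card (N i))"
      using that by (intro sum_mono2) auto
    then show ?thesis using off[of "i + 1"] off[of m] that by simp
  qed
  have core: "runs (Seq levels_program cover_output) s
      ((200 * (\<Sum>i<m. card (N i)) + 120 * m + 20) + (50 * n + 50)) (\<lambda>s. \<forall>j<n. rmem s ''x'' j = ?z j)"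
    if nm: "\<forall>a. a \<noteq> ''k'' \<longrightarrow> nmem s a = nmem s0 a"
      and yo: "\<forall>j<n. rmem s ''open'' j = rmem s0 ''cost'' j \<and> rmem s ''y'' j = 0"
      and d0: "\<forall>k<?off m. rmem s ''dist'' k = 0" for s
  proof (rule runs_Seq)
    have eqs: "nmem s ''m'' = nmem s0 ''m''" "nmem s ''n'' = nmem s0 ''n''"
      "nmem s ''off'' = ?off" "nmem s ''adj'' = nmem s0 ''adj''" using nm by auto
    have "rmem s ''dist'' k = 0" if "i < m" "k \<in> {?off i..<?off (i + 1)}" for i k
      using d0 le[OF that(1)] that(2) by auto
    moreover have "rmem s ''open'' j = f j" if "i < m" "j \<in> N i" for i j
      using yo N(1)[OF that(1)] that(2) cst by (auto simp: cover_stored_def)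
    ultimately have st: "stored s"
      using cst unfolding cover_stored_def stored_def eqs by blast
    from levels_program_runs[OF st N(1)]
    have "runs levels_program s (200 * (\<Sum>i<m. card (N i)) + 120 * m + 20)
      (\<lambda>s'. frame s s' \<and> (\<forall>j\<in>{..<n}. rmem s' ''y'' j = levels m j) \<and>
       (\<forall>i<m. \<forall>k\<in>{nmem s ''off'' i..<nmem s ''off'' (Suc i)}. rmem s' ''x'' k = flag i (nmem s ''adj'' k)))"
      using yo by auto
    then show "runs levels_program s (200 * (\<Sum>i<m. card (N i)) + 120 * m + 20)
      (\<lambda>s. runs cover_output s (50 * n + 50) (\<lambda>s. \<forall>j<n. rmem s ''x'' j = ?z j))"
    proof (rule runs_mono[OF _ order_refl], elim conjE)
      fix s' assume "frame s s'" and y: "\<forall>j\<in>{..<n}. rmem s' ''y'' j = levels m j"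
      then have n': "nmem s' ''n'' 0 = n" using n eqs by (simp add: frame_mem[of s s'])
      show "runs cover_output s' (50 * n + 50) (\<lambda>s. \<forall>j<n. rmem s ''x'' j = ?z j)"
        using cover_output_runs[of s'] y unfolding n' by (elim runs_mono) (auto simp: cover_solution_def)
    qed
  qed
  have "runs cover_program s0 ((50 * (n + ?off m) + 100) +
      ((200 * (\<Sum>i<m. card (N i)) + 120 * m + 20) + (50 * n + 50))) (\<lambda>s. \<forall>j<n. rmem s ''x'' j = ?z j)"
    unfolding cover_program_def
    by (rule runs_Seq, rule runs_mono[OF cover_init_runs[of s0, unfolded n m] order_refl],
        elim conjE, rule core)
  then show ?thesis
    by (rule runs_mono) (simp_all add: off)
qed

lemma sc_covering_eq_linear:
  "sc_covering I = linear_covering {..<num_sets I} (set_cost I) (containing I ` {..<elements I})"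
proof -
  have "finite (containing I e)" for e by (simp add: containing_def)
  then show ?thesis
    by (simp add: sc_covering_def linear_covering_def image_image cover_eq_floor_sum)
qed

text \<open>Double counting of incidences: the program scans them by element, whereas
  \<open>sc_size\<close> counts them by set.\<close>

lemma sum_card_containing:
  assumes "set_cover I"
  shows "(\<Sum>e<elements I. card (containing I e)) = (\<Sum>j<num_sets I. card (members I j))"
proof -
  have "(\<Sum>e<elements I. card (containing I e)) = (\<Sum>e<elements I. card {j \<in> {..<num_sets I}. e \<in> members I j})"
    by (simp add: containing_def)
  also have "\<dots> = (\<Sum>j<num_sets I. card {e \<in> {..<elements I}. e \<in> members I j})"
    by (rule sum_multicount_gen) auto
  also have "\<dots> = (\<Sum>j<num_sets I. card (members I j))"
    using assms by (intro sum.cong arg_cong[where f = card]) (auto simp: set_cover_def)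
  finally show ?thesis .
qed

lemma linear_time_greedy_set_cover:
  "linear_time_greedy set_cover sc_covering sc_size sc_input sc_output"
proof (rule linear_time_greedyI[where p = cover_program and K = 250])
  fix I s
  assume I: "set_cover I" and inp: "sc_input I s"
  have "cover_stored (elements I) (containing I) (num_sets I) (set_cost I) s"
    using inp unfolding sc_input_def cover_stored_def by blast
  from cover_program_runs[OF this]
  have "runs cover_program s (250 * (sc_size I + 1))
      (\<lambda>s'. sc_output I s s' (cover_solution (elements I) (containing I) (set_cost I)))"
    using I unfolding sc_size_def sc_output_def sum_card_containing[OF I]
    by (auto simp: set_cover_def containing_def)
  moreover have "greedy_result (sc_covering I) z \<and> Delta_approximate (sc_covering I) z"
    if "z = cover_solution (elements I) (containing I) (set_cost I)" for z
    unfolding sc_covering_eq_linear that using I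
    by (intro linear_levels_result) (auto simp: set_cover_def containing_def)
  ultimately show "\<exists>z. runs cover_program s (250 * (sc_size I + 1)) (\<lambda>s'. sc_output I s s' z) \<and>
      greedy_result (sc_covering I) z \<and> Delta_approximate (sc_covering I) z"
    by blast
qed

text \<open>Makes every edge an element contained in two sets, its end points. Its block consists of
  positions \<open>2 * i\<close> and \<open>2 * i + 1\<close>.\<close>

definition edge_list_init :: com where
  "edge_list_init = Seq (Seq (nassign ''i'' (NConst 0)) (nassign ''off'' (NConst 0)))
     (While (NLess (nvar ''i'') (nvar ''m''))
       (Seq (NStore ''off'' (NAdd (nvar ''i'') (NConst 1)) (NAdd (NLoad ''off'' (nvar ''i'')) (NConst 2)))
       (Seq (NStore ''adj'' (NLoad ''off'' (nvar ''i'')) (NLoad ''tail'' (nvar ''i'')))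
       (Seq (NStore ''adj'' (NAdd (NLoad ''off'' (nvar ''i'')) (NConst 1)) (NLoad ''head'' (nvar ''i'')))
       (incr ''i'')))))"

lemma edge_list_init_runs:
  "runs edge_list_init s0 (50 * nmem s0 ''m'' 0 + 50)
    (\<lambda>s. nmem s ''m'' = nmem s0 ''m'' \<and> nmem s ''n'' = nmem s0 ''n'' \<and> rmem s = rmem s0 \<and>
       (\<forall>i\<le>nmem s0 ''m'' 0. nmem s ''off'' i = 2 * i) \<and>
       (\<forall>i<nmem s0 ''m'' 0. nmem s ''adj'' (2 * i) = nmem s0 ''tail'' i \<and>
          nmem s ''adj'' (2 * i + 1) = nmem s0 ''head'' i))"
proof -
  let ?m = "nmem s0 ''m'' 0"
  define inv where "inv i s \<longleftrightarrow> (\<forall>a. a \<notin> {''i'', ''off'', ''adj''} \<longrightarrow> nmem s a = nmem s0 a) \<and>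
    rmem s = rmem s0 \<and> nmem s ''i'' 0 = i \<and> (\<forall>i'\<le>i. nmem s ''off'' i' = 2 * i') \<and>
    (\<forall>i'<i. nmem s ''adj'' (2 * i') = nmem s0 ''tail'' i' \<and>
      nmem s ''adj'' (2 * i' + 1) = nmem s0 ''head'' i')" for i and s :: memory
  let ?b = "NLess (nvar ''i'') (nvar ''m'')"
  let ?p = "Seq (NStore ''off'' (NAdd (nvar ''i'') (NConst 1)) (NAdd (NLoad ''off'' (nvar ''i'')) (NConst 2)))
       (Seq (NStore ''adj'' (NLoad ''off'' (nvar ''i'')) (NLoad ''tail'' (nvar ''i'')))
       (Seq (NStore ''adj'' (NAdd (NLoad ''off'' (nvar ''i'')) (NConst 1)) (NLoad ''head'' (nvar ''i'')))
       (incr ''i'')))"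
  let ?q = "Seq (nassign ''i'' (NConst 0)) (nassign ''off'' (NConst 0))"
  have "runs (While ?b ?p) (effect ?q s0) ((?m - 0) * (duration ?p + 1 + btime ?b) + 1 + btime ?b) (inv ?m)"
  proof (rule runs_While_straight)
    fix i s assume inv: "inv i s"
    have s: "nmem s ''i'' 0 = i" "nmem s ''off'' i = 2 * i"
      "nmem s ''tail'' = nmem s0 ''tail''" "nmem s ''head'' = nmem s0 ''head''"
      using inv by (auto simp: inv_def)
    show "inv (Suc i) (effect ?p s)"
      using inv s unfolding inv_def by (auto simp: less_Suc_eq le_Suc_eq)
  next
    show "bval ?b s \<longleftrightarrow> i < ?m" if "inv i s" for i s
      using that by (auto simp: inv_def)
    show "inv 0 (effect ?q s0)" by (simp add: inv_def)
  qed simp_all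
  then have "runs edge_list_init s0 (duration ?q +
      ((?m - 0) * (duration ?p + 1 + btime ?b) + 1 + btime ?b)) (inv ?m)"
    unfolding edge_list_init_def by (intro runs_Seq_straight) simp_all
  then show ?thesis
    by (rule runs_mono) (auto simp: inv_def)
qed

context
  fixes I :: vertex_cover_instance
  assumes I: "vertex_cover I"
begin

lemma edge_subset: "e \<in> edges I \<Longrightarrow> e \<subseteq> {..<vertices I}"
  and card_edge: "e \<in> edges I \<Longrightarrow> card e = 2"
  using I by (auto simp: vertex_cover_def)

lemma vc_covering_eq_linear:
  "vc_covering I = linear_covering {..<vertices I} (vertex_cost I) (edges I)"
proof -
  let ?V = "{..<vertices I}"
  have *: "{x \<in> orthant ?V. \<lfloor>x u\<rfloor> + \<lfloor>x w\<rfloor> \<ge> 1} = cover ?V {u, w}" if "{u, w} \<in> edges I" for u w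
  proof -
    \<comment> \<open>With distinct end points the sum over the set \<open>{u, w}\<close> really has
      two summands.\<close>
    have "u \<noteq> w" using card_edge[OF that] by auto
    then show ?thesis using cover_eq_floor_sum[of "{u, w}" ?V] by simp
  qed
  have "{{x \<in> orthant ?V. \<lfloor>x u\<rfloor> + \<lfloor>x w\<rfloor> \<ge> 1} | u w. {u, w} \<in> edges I} = cover ?V ` edges I"
  proof (intro equalityI subsetI)
    fix S assume "S \<in> {{x \<in> orthant ?V. \<lfloor>x u\<rfloor> + \<lfloor>x w\<rfloor> \<ge> 1} | u w. {u, w} \<in> edges I}"
    then show "S \<in> cover ?V ` edges I" using * by blast
  next
    fix S assume "S \<in> cover ?V ` edges I"
    then obtain e where e: "e \<in> edges I" "S = cover ?V e" by blast
    obtain u w where "e = {u, w}" using card_edge[OF e(1)] by (auto simp: card_2_iff)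
    then show "S \<in> {{x \<in> orthant ?V. \<lfloor>x u\<rfloor> + \<lfloor>x w\<rfloor> \<ge> 1} | u w. {u, w} \<in> edges I}"
      using e * by blast
  qed
  then show ?thesis by (simp add: vc_covering_def linear_covering_def)
qed

lemma vertex_cover_program_runs:
  assumes inp: "vc_input I s"
  shows "\<exists>z. runs (Seq edge_list_init cover_program) s (1000 * (vc_size I + 1)) (\<lambda>s'. vc_output I s s' z) \<and>
      greedy_result (vc_covering I) z \<and> Delta_approximate (vc_covering I) z"
proof -
  let ?m = "card (edges I)" and ?n = "vertices I" and ?f = "vertex_cost I"
  define N where "N = (\<lambda>i. {nmem s ''tail'' i, nmem s ''head'' i})"
  define z where "z = cover_solution ?m N ?f"
  have bij: "bij_betw N {..<?m} (edges I)"
    using inp by (simp add: vc_input_def N_def)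
  have mn: "nmem s ''m'' 0 = ?m" "nmem s ''n'' 0 = ?n"
    using inp by (auto simp: vc_input_def)
  have edge: "N i \<in> edges I" if "i < ?m" for i
    using bij that by (auto simp: bij_betw_def)
  have N: "N i \<subseteq> {..<?n}" "N i \<noteq> {}" "card (N i) = 2" if "i < ?m" for i
    using edge_subset[OF edge[OF that]] card_edge[OF edge[OF that]] by auto
  have f: "0 \<le> ?f v" if "v < ?n" for v
    using I that by (simp add: vertex_cover_def)
  have "runs (Seq edge_list_init cover_program) s ((50 * ?m + 50) +
      250 * (?n + ?m + (\<Sum>i<?m. card (N i)) + 1)) (\<lambda>s'. \<forall>j<?n. rmem s' ''x'' j = z j)"
  proof (rule runs_Seq, rule runs_mono[OF edge_list_init_runs[of s, unfolded mn] order_refl], elim conjE)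
    fix s' :: memory assume s': "nmem s' ''m'' = nmem s ''m''" "nmem s' ''n'' = nmem s ''n''" "rmem s' = rmem s"
      and off: "\<forall>i\<le>?m. nmem s' ''off'' i = 2 * i"
      and adj: "\<forall>i<?m. nmem s' ''adj'' (2 * i) = nmem s ''tail'' i \<and>
        nmem s' ''adj'' (2 * i + 1) = nmem s ''head'' i"
    have "bij_betw (nmem s' ''adj'') {2 * i..<2 * (i + 1)} (N i)" if "i < ?m" for i
    proof -
      have "nmem s ''tail'' i \<noteq> nmem s ''head'' i"
        using N(3)[OF that] by (auto simp: N_def)
      moreover have "{2 * i..<2 * (i + 1)} = {2 * i, 2 * i + 1}" by auto
      ultimately show ?thesis using adj that by (auto simp: bij_betw_def N_def)
    qed
    then have "cover_stored ?m N ?n ?f s'"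
      using off s' mn N(3) inp by (auto simp: cover_stored_def vc_input_def)
    from cover_program_runs[OF this f N(1,2)]
    show "runs cover_program s' (250 * (?n + ?m + (\<Sum>i<?m. card (N i)) + 1)) (\<lambda>s'. \<forall>j<?n. rmem s' ''x'' j = z j)"
      by (simp add: z_def)
  qed
  then have "runs (Seq edge_list_init cover_program) s (1000 * (vc_size I + 1)) (\<lambda>s'. vc_output I s s' z)"
    by (rule runs_mono) (simp_all add: N(3) vc_size_def vc_output_def)
  moreover have "vc_covering I = linear_covering {..<?n} ?f (N ` {..<?m})"
    using bij by (simp add: vc_covering_eq_linear bij_betw_def)
  then have "greedy_result (vc_covering I) z \<and> Delta_approximate (vc_covering I) z"
    unfolding z_def using f N by (simp only:) (intro linear_levels_result, auto)
  ultimately show ?thesis by blast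
qed

end

text \<open>The program and the constant are left schematic and are fixed by unification with
  \<open>vertex_cover_program_runs\<close>.\<close>

lemma linear_time_greedy_vertex_cover:
  "linear_time_greedy vertex_cover vc_covering vc_size vc_input vc_output"
  by (rule linear_time_greedyI) (rule vertex_cover_program_runs)

theorem theorem2:
  shows
    "linear_time_greedy facility_location fl_covering fl_size fl_input fl_output \<and>
     linear_time_greedy set_cover sc_covering sc_size sc_input sc_output \<and>
     linear_time_greedy vertex_cover vc_covering vc_size vc_input vc_output \<and>
     (\<forall>I. facility_location I \<longrightarrow> monotone_covering (fl_covering I) \<and>
        Delta (fl_covering I) = (SUP i\<in>{..<customers I}. card (serving I i))) \<and>
     (\<forall>I. set_cover I \<longrightarrow> monotone_covering (sc_covering I) \<and>
        Delta (sc_covering I) = (SUP e\<in>{..<elements I}. card (containing I e))) \<and>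
     (\<forall>I. vertex_cover I \<longrightarrow> monotone_covering (vc_covering I) \<and>
        (edges I \<noteq> {} \<longrightarrow> Delta (vc_covering I) = 2))"
proof (intro conjI allI impI)
  fix I assume I: "set_cover I"
  then show "monotone_covering (sc_covering I)"
    unfolding sc_covering_eq_linear by (intro monotone_covering_linear) (auto simp: set_cover_def)
  have "Delta (sc_covering I) = (SUP U\<in>containing I ` {..<elements I}. card U)"
    unfolding sc_covering_eq_linear by (rule Delta_linear) (auto simp: containing_def)
  then show "Delta (sc_covering I) = (SUP e\<in>{..<elements I}. card (containing I e))"
    by (simp add: image_image)
next
  fix I assume I: "vertex_cover I"
  then show "monotone_covering (vc_covering I)"
    unfolding vc_covering_eq_linear[OF I]
    by (intro monotone_covering_linear) (auto simp: vertex_cover_def)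
  assume ne: "edges I \<noteq> {}"
  have "Delta (vc_covering I) = (SUP U\<in>edges I. card U)"
    unfolding vc_covering_eq_linear[OF I] by (rule Delta_linear) (rule edge_subset[OF I])
  also have "\<dots> = (SUP U\<in>edges I. 2)"
    using card_edge[OF I] by (intro SUP_cong) auto
  finally show "Delta (vc_covering I) = 2"
    using ne by simp
qed (simp_all add: linear_time_greedy_facility_location linear_time_greedy_set_cover
    linear_time_greedy_vertex_cover monotone_covering_fl Delta_fl)

end
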